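(* Let $d\ge1$ be an integer and let $\phi_d(\mathbf{x},t)$, $(\mathbf{x},t)\in\mathbb{R}^d\times(0,\infty)$, be a centered Gaussian field with $\mathcal{C}^\infty(\mathbb{R}^d\times(0,\infty))$ sample functions, satisfying the heat equation $\partial\phi_d/\partial t=\Delta\phi_d$ on $\mathbb{R}^d\times(0,\infty)$, and with covariance $\mathbb{E}[\phi_d(\mathbf{x}_1,t)\phi_d(\mathbf{x}_2,s)]=K_{t+s}(\mathbf{x}_1-\mathbf{x}_2)$, where $K_t(\mathbf{x})=(4\pi t)^{-d/2}\exp\{-\|\mathbf{x}\|_2^2/(4t)\}$. Then, with $\alpha=d/2-1$, for each fixed $\mathbf{x}\in\mathbb{R}^d$, $$\lim_{T\to\infty}\frac{1}{\log T}\log\mathbb{P}\bigl(\phi_d(\mathbf{x},t)\ne 0\ \ \forall t\in[1,T]\bigr)=-b_\alpha,$$ and, for $d=1$, $$\lim_{R\to\infty}\frac1R\log\mathbb{P}\bigl(\phi_1(x,1)\neq 0\ \ \forall |x|\le R/2\bigr)=-\hat b_\infty .$$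
   Context: For $\alpha>-1$, let $\{Y^{(\alpha)}_t\}_{t\in\mathbb{R}}$ be the centered stationary Gaussian process with $\mathcal{C}^\infty$ sample paths and covariance $[\operatorname{sech}((t-s)/2)]^{\alpha+1}$, and $b_\alpha:=-\lim_{T\to\infty}\frac1T\log\mathbb{P}(\sup_{t\in[0,T]}Y^{(\alpha)}_t\le 0)$, a limit which exists. $\hat b_\infty$ denotes the (finite) persistence exponent of the centered stationary Gaussian process $\{\widehat Z_t\}_{t\ge0}$ with continuous sample paths and covariance $\exp\{-(t-s)^2/8\}$, that is, $\hat b_\infty:=-\lim_{T\to\infty}\frac1T\log\mathbb{P}(\sup_{t\in[0,T]}\widehat Z_t<0)$. *)

theory Defs
  imports "HOL-Probability.Probability"
begin

text \<open>Degenerate (identically zero) variables count as centered normal.\<close>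

definition centered_normal :: "'w measure \<Rightarrow> ('w \<Rightarrow> real) \<Rightarrow> bool" where
  "centered_normal M X \<longleftrightarrow>
     X \<in> borel_measurable M \<and>
     ((AE \<omega> in M. X \<omega> = 0) \<or>
      (\<exists>\<sigma>>0. distributed M lborel X (normal_density 0 \<sigma>)))"

definition centered_gaussian_process ::
    "'w measure \<Rightarrow> 'i set \<Rightarrow> ('i \<Rightarrow> 'w \<Rightarrow> real) \<Rightarrow> ('i \<Rightarrow> 'i \<Rightarrow> real) \<Rightarrow> bool" where
  "centered_gaussian_process M I X C \<longleftrightarrow>
     prob_space M \<and>
     (\<forall>J c. finite J \<longrightarrow> J \<subseteq> I \<longrightarrow> centered_normal M (\<lambda>\<omega>. \<Sum>j\<in>J. c j * X j \<omega>)) \<and>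
     (\<forall>s\<in>I. \<forall>t\<in>I. prob_space.expectation M (\<lambda>\<omega>. X s \<omega> * X t \<omega>) = C s t)"

text \<open>Smoothness is only meant for open \<open>S\<close>: the derivatives are taken in the full space,
  and all iterated directional derivatives are required to be differentiable on \<open>S\<close>.\<close>

primrec n_times_differentiable_on ::
    "nat \<Rightarrow> ('a::real_normed_vector \<Rightarrow> 'b::real_normed_vector) \<Rightarrow> 'a set \<Rightarrow> bool" where
  "n_times_differentiable_on 0 f S \<longleftrightarrow> continuous_on S f"
| "n_times_differentiable_on (Suc n) f S \<longleftrightarrow>
     (\<forall>x\<in>S. f differentiable (at x)) \<and>
     (\<forall>v. n_times_differentiable_on n (\<lambda>x. frechet_derivative f (at x) v) S)"

definition C_infinity_on ::
    "('a::real_normed_vector \<Rightarrow> 'b::real_normed_vector) \<Rightarrow> 'a set \<Rightarrow> bool" where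
  "C_infinity_on f S \<longleftrightarrow> (\<forall>n. n_times_differentiable_on n f S)"

definition laplacian :: "(real ^ 'd \<Rightarrow> real) \<Rightarrow> real ^ 'd \<Rightarrow> real" where
  "laplacian f x = (\<Sum>i\<in>UNIV. (deriv ^^ 2) (\<lambda>h. f (x + h *\<^sub>R axis i 1)) 0)"

definition heat_kernel :: "real \<Rightarrow> real ^ 'd \<Rightarrow> real" where
  "heat_kernel t x =
     (4 * pi * t) powr (- (real CARD('d) / 2)) * exp (- (norm x)\<^sup>2 / (4 * t))"

definition gaussian_heat_field ::
    "'w measure \<Rightarrow> ((real ^ 'd) \<times> real \<Rightarrow> 'w \<Rightarrow> real) \<Rightarrow> bool" where
  "gaussian_heat_field M \<phi> \<longleftrightarrow>
     centered_gaussian_process M (UNIV \<times> {0<..}) \<phi>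
       (\<lambda>(x\<^sub>1, t) (x\<^sub>2, s). heat_kernel (t + s) (x\<^sub>1 - x\<^sub>2)) \<and>
     (\<forall>\<omega>\<in>space M.
        C_infinity_on (\<lambda>p. \<phi> p \<omega>) (UNIV \<times> {0<..}) \<and>
        (\<forall>x. \<forall>t>0. deriv (\<lambda>s. \<phi> (x, s) \<omega>) t = laplacian (\<lambda>y. \<phi> (y, t) \<omega>) x))"

definition sech_process :: "real \<Rightarrow> 'w measure \<Rightarrow> (real \<Rightarrow> 'w \<Rightarrow> real) \<Rightarrow> bool" where
  "sech_process \<alpha> M Y \<longleftrightarrow>
     centered_gaussian_process M UNIV Y (\<lambda>t s. (1 / cosh ((t - s) / 2)) powr (\<alpha> + 1)) \<and>
     (\<forall>\<omega>\<in>space M. C_infinity_on (\<lambda>t. Y t \<omega>) UNIV)"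

definition squared_exp_process :: "'w measure \<Rightarrow> (real \<Rightarrow> 'w \<Rightarrow> real) \<Rightarrow> bool" where
  "squared_exp_process M Z \<longleftrightarrow>
     centered_gaussian_process M {0..} Z (\<lambda>t s. exp (- (t - s)\<^sup>2 / 8)) \<and>
     (\<forall>\<omega>\<in>space M. continuous_on {0..} (\<lambda>t. Z t \<omega>))"

text \<open>The exponents depend only on the law of the process, i.e. on its covariance. They are
  relations that hold only if the limit exists and is finite. For continuous paths the suprema
  range over bounded sets, so the real-valued \<open>SUP\<close> is meaningful.\<close>

definition has_weak_persistence_exponent ::
    "'w measure \<Rightarrow> (real \<Rightarrow> 'w \<Rightarrow> real) \<Rightarrow> real \<Rightarrow> bool" where
  "has_weak_persistence_exponent M Y b \<longleftrightarrow>
     ((\<lambda>T. 1 / T * ln (measure M {\<omega> \<in> space M. (SUP t\<in>{0..T}. Y t \<omega>) \<le> 0}))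
        \<longlongrightarrow> - b) at_top"

definition has_strict_persistence_exponent ::
    "'w measure \<Rightarrow> (real \<Rightarrow> 'w \<Rightarrow> real) \<Rightarrow> real \<Rightarrow> bool" where
  "has_strict_persistence_exponent M Z b \<longleftrightarrow>
     ((\<lambda>T. 1 / T * ln (measure M {\<omega> \<in> space M. (SUP t\<in>{0..T}. Z t \<omega>) < 0}))
        \<longlongrightarrow> - b) at_top"

end

theory Submission
  imports Defs
begin

text \<open>
  Both limits compare the heat field with a stationary Gaussian process on an interval.
  At a fixed point of space, the normalized field in logarithmic time has the covariance
  of the sech process with \<open>\<alpha> + 1 = d / 2\<close>; at time one and in dimension one, the normalized
  field along a segment has the covariance \<open>exp (- (t - s)\<^sup>2 / 8)\<close>. The interval \<open>[1, T]\<close>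
  becomes \<open>[0, ln T]\<close>, and the ball of radius \<open>R / 2\<close> becomes an interval of length \<open>R\<close>. A path
  without zeros is everywhere positive or everywhere negative, and by symmetry the probability of
  having no zero is twice the probability of being negative (\<open>prob_path_nonzero_eq\<close>). The factor
  two disappears in the logarithmic limit (\<open>ln_twice_limit\<close>).

  The two processes live on different probability spaces, so everything rests on the fact that
  the covariance determines the probabilities of path events. For finitely many times this is the
  theorem of Cramer and Wold for lower orthants, \<open>gaussian_orthant_prob_eq\<close>. It is reduced to
  uniqueness of characteristic functions on the line: starting from the joint characteristic
  function, one coordinate after another is converted from an oscillating factor to an indicator,
  with weights \<open>1 + cos\<close> that keep the measures positive. Continuity of the paths then extends the
  equality to events over compact sets of times (\<open>prob_path_le_eq\<close>, \<open>prob_path_less_eq\<close>).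

  The exponent of the sech process is defined by a supremum that is at most zero, while the
  absence of zeros needs a strict inequality. The two events differ by a null set because a smooth
  path of a process with unit variance almost surely has no zero that is also a local maximum
  (\<open>smooth_prob_le_eq_less\<close>). For the squared exponential process the inequality is strict
  already, so continuity of the paths is enough.
\<close>

section \<open>Normal variables and Gaussian processes\<close>

lemma centered_normal_measurable: "centered_normal M X \<Longrightarrow> X \<in> borel_measurable M"
  by (simp add: centered_normal_def)

lemma centered_normal_integrable_square:
  assumes "prob_space M" "centered_normal M X"
  shows "integrable M (\<lambda>\<omega>. (X \<omega>)\<^sup>2)"
proof -
  interpret prob_space M by fact
  have [measurable]: "X \<in> borel_measurable M"
    using assms(2) by (rule centered_normal_measurable)
  from assms(2) consider "AE \<omega> in M. X \<omega> = 0"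
    | \<sigma> where "\<sigma> > 0" "distributed M lborel X (normal_density 0 \<sigma>)"
    by (auto simp: centered_normal_def)
  then show ?thesis
  proof cases
    case 1
    then show ?thesis
      by (subst integrable_cong_AE[where g = "\<lambda>_. 0"]) auto
  next
    case 2
    then show ?thesis
      using integrable_normal_moment[of \<sigma> 0 2]
        distributed_integrable[of M lborel X "normal_density 0 \<sigma>" "\<lambda>x. x\<^sup>2"]
      by simp
  qed
qed

lemma centered_normal_cases:
  assumes "prob_space M" "centered_normal M X"
  obtains "AE \<omega> in M. X \<omega> = 0" "prob_space.expectation M (\<lambda>\<omega>. (X \<omega>)\<^sup>2) = 0"
  | \<sigma> where "\<sigma> > 0" "distributed M lborel X (normal_density 0 \<sigma>)"
      "prob_space.expectation M (\<lambda>\<omega>. (X \<omega>)\<^sup>2) = \<sigma>\<^sup>2"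
proof -
  interpret prob_space M by fact
  have [measurable]: "X \<in> borel_measurable M"
    using assms(2) by (rule centered_normal_measurable)
  from assms(2) consider "AE \<omega> in M. X \<omega> = 0"
    | \<sigma> where "\<sigma> > 0" "distributed M lborel X (normal_density 0 \<sigma>)"
    by (auto simp: centered_normal_def)
  then show thesis
  proof cases
    case 1
    then have "expectation (\<lambda>\<omega>. (X \<omega>)\<^sup>2) = expectation (\<lambda>\<omega>. 0)"
      by (intro integral_cong_AE) auto
    with 1 show thesis by (intro that(1)) auto
  next
    case 2
    then show thesis
      using normal_distributed_variance[of \<sigma> X 0] normal_distributed_expectation[of \<sigma> X 0]
      by (intro that(2)) auto
  qed
qed

text \<open>Centered normal laws form a one-parameter family, so matching second moments match the whole
  law. The degenerate case pairs with itself only, because a nondegenerate normal variable has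
  positive variance.\<close>

lemma centered_normal_expectation_eq:
  assumes M: "prob_space M" "centered_normal M X" and N: "prob_space N" "centered_normal N Y"
    and var: "prob_space.expectation M (\<lambda>\<omega>. (X \<omega>)\<^sup>2) = prob_space.expectation N (\<lambda>\<omega>. (Y \<omega>)\<^sup>2)"
    and f: "f \<in> borel_measurable (borel :: real measure)"
  shows "prob_space.expectation M (\<lambda>\<omega>. f (X \<omega>)) = (prob_space.expectation N (\<lambda>\<omega>. f (Y \<omega>)) :: real)"
proof -
  note [measurable] = f
  have [measurable]: "X \<in> borel_measurable M" "Y \<in> borel_measurable N"
    using M N by (auto intro: centered_normal_measurable)
  have degenerate: "integral\<^sup>L P (\<lambda>\<omega>. f (V \<omega>)) = f 0"
    if "prob_space P" "AE \<omega> in P. V \<omega> = 0" and [measurable]: "V \<in> borel_measurable P" for P :: "'v measure" and V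
  proof -
    interpret prob_space P by fact
    have "expectation (\<lambda>\<omega>. f (V \<omega>)) = expectation (\<lambda>\<omega>. f 0)"
      using that by (intro integral_cong_AE) auto
    then show ?thesis by (simp add: prob_space)
  qed
  from M show ?thesis
  proof (cases rule: centered_normal_cases)
    case X: 1
    from N show ?thesis
      by (cases rule: centered_normal_cases)
         (use X var M N in \<open>simp_all add: degenerate[of M X] degenerate[of N Y]\<close>)
  next
    case X: (2 \<sigma>)
    from N show ?thesis
    proof (cases rule: centered_normal_cases)
      case 1
      then show ?thesis using X var by simp
    next
      case Y: (2 \<tau>)
      then have "\<sigma> = \<tau>"
        using X var by simp
      then show ?thesis
        using distributed_integral[OF X(2), of f] distributed_integral[OF Y(2), of f] by simp
    qed
  qed
qed

lemma gaussian_process_prob_space: "centered_gaussian_process M I X C \<Longrightarrow> prob_space M"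
  by (simp add: centered_gaussian_process_def)

lemma gaussian_process_sum_normal:
  "centered_gaussian_process M I X C \<Longrightarrow> finite J \<Longrightarrow> J \<subseteq> I \<Longrightarrow>
    centered_normal M (\<lambda>\<omega>. \<Sum>j\<in>J. c j * X j \<omega>)"
  by (simp add: centered_gaussian_process_def)

lemma gaussian_process_cov:
  "centered_gaussian_process M I X C \<Longrightarrow> s \<in> I \<Longrightarrow> t \<in> I \<Longrightarrow>
    prob_space.expectation M (\<lambda>\<omega>. X s \<omega> * X t \<omega>) = C s t"
  by (simp add: centered_gaussian_process_def)

lemma gaussian_process_normal:
  assumes "centered_gaussian_process M I X C" "i \<in> I"
  shows "centered_normal M (X i)"
  using gaussian_process_sum_normal[OF assms(1), of "{i}" "\<lambda>_. 1"] assms(2) by simp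

lemma gaussian_process_measurable:
  assumes "centered_gaussian_process M I X C" "i \<in> I"
  shows "X i \<in> borel_measurable M"
  by (rule centered_normal_measurable[OF gaussian_process_normal[OF assms]])

text \<open>Only linear combinations are assumed normal. The products \<open>X i * X j\<close> are
  integrable because they are dominated by the sum of two squares, each integrable by
  normality.\<close>

lemma gaussian_process_variance:
  assumes X: "centered_gaussian_process M I X C" and J: "finite J" "J \<subseteq> I"
  shows "prob_space.expectation M (\<lambda>\<omega>. (\<Sum>j\<in>J. c j * X j \<omega>)\<^sup>2)
    = (\<Sum>i\<in>J. \<Sum>j\<in>J. c i * c j * C i j)"
proof -
  interpret prob_space M using X by (rule gaussian_process_prob_space)
  have cov: "expectation (\<lambda>\<omega>. X i \<omega> * X j \<omega>) = C i j" if "i \<in> J" "j \<in> J" for i j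
    using gaussian_process_cov[OF X] J(2) that by blast
  have meas: "X i \<in> borel_measurable M" if "i \<in> J" for i
    using gaussian_process_measurable[OF X] J that by auto
  have int: "integrable M (\<lambda>\<omega>. X i \<omega> * X j \<omega>)" if "i \<in> J" "j \<in> J" for i j
  proof (rule Bochner_Integration.integrable_bound)
    show "integrable M (\<lambda>\<omega>. (X i \<omega>)\<^sup>2 + (X j \<omega>)\<^sup>2)"
      using that J by (intro Bochner_Integration.integrable_add centered_normal_integrable_square
          gaussian_process_normal[OF X] prob_space_axioms) auto
    show "(\<lambda>\<omega>. X i \<omega> * X j \<omega>) \<in> borel_measurable M"
      using that meas by (intro borel_measurable_times) auto
    have "\<bar>x * y\<bar> \<le> x\<^sup>2 + y\<^sup>2" for x y :: real
    proof -
      have "0 \<le> (\<bar>x\<bar> - \<bar>y\<bar>)\<^sup>2" by simp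
      then have "2 * \<bar>x * y\<bar> \<le> x\<^sup>2 + y\<^sup>2"
        by (simp add: power2_diff abs_mult)
      then show ?thesis by linarith
    qed
    then show "AE \<omega> in M. norm (X i \<omega> * X j \<omega>) \<le> norm ((X i \<omega>)\<^sup>2 + (X j \<omega>)\<^sup>2)"
      by (intro AE_I2) (simp add: abs_of_nonneg)
  qed
  have "expectation (\<lambda>\<omega>. (\<Sum>j\<in>J. c j * X j \<omega>)\<^sup>2)
      = expectation (\<lambda>\<omega>. \<Sum>i\<in>J. \<Sum>j\<in>J. c i * c j * (X i \<omega> * X j \<omega>))"
    by (simp add: power2_eq_square sum_product algebra_simps)
  also have "\<dots> = (\<Sum>i\<in>J. \<Sum>j\<in>J. c i * c j * C i j)"
    by (simp add: int cov)
  finally show ?thesis .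
qed

text \<open>Equality of the joint characteristic functions, in real form: the phase
  \<open>\<theta>\<close> covers both the real and the imaginary part. The covariance
  determines the variance of the linear combination, hence its law.\<close>

lemma gaussian_cos_expectation_eq:
  assumes X: "centered_gaussian_process M I X C" and Y: "centered_gaussian_process N I Y C"
    and J: "finite J" "J \<subseteq> I"
  shows "prob_space.expectation M (\<lambda>\<omega>. cos ((\<Sum>j\<in>J. c j * X j \<omega>) + \<theta>))
    = prob_space.expectation N (\<lambda>\<omega>. cos ((\<Sum>j\<in>J. c j * Y j \<omega>) + \<theta>))"
proof (rule centered_normal_expectation_eq[where f = "\<lambda>x. cos (x + \<theta>)"])
  show "prob_space.expectation M (\<lambda>\<omega>. (\<Sum>j\<in>J. c j * X j \<omega>)\<^sup>2)
      = prob_space.expectation N (\<lambda>\<omega>. (\<Sum>j\<in>J. c j * Y j \<omega>)\<^sup>2)"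
    by (simp add: gaussian_process_variance[OF X J] gaussian_process_variance[OF Y J])
  show "centered_normal M (\<lambda>\<omega>. \<Sum>j\<in>J. c j * X j \<omega>)"
      "centered_normal N (\<lambda>\<omega>. \<Sum>j\<in>J. c j * Y j \<omega>)"
    by (rule gaussian_process_sum_normal[OF X J] gaussian_process_sum_normal[OF Y J])+
  show "prob_space M" "prob_space N"
    by (rule gaussian_process_prob_space[OF X] gaussian_process_prob_space[OF Y])+
qed simp

section \<open>Covariance determines finite-dimensional laws\<close>

text \<open>Normalizing a nonnegative weight makes a probability measure, to which one-dimensional
  uniqueness of characteristic functions applies. The phase \<open>- pi / 2\<close> turns the
  cosine into a sine.\<close>

lemma weighted_law:
  fixes W :: "'w \<Rightarrow> real" and X :: "'w \<Rightarrow> real"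
  assumes [measurable]: "X \<in> borel_measurable M" and int: "integrable M W"
    and W: "\<And>\<omega>. 0 \<le> W \<omega>" and m: "integral\<^sup>L M W > 0"
  defines "Q \<equiv> distr (density M (\<lambda>\<omega>. W \<omega> / integral\<^sup>L M W)) borel X"
  shows real_distribution_weighted_law: "real_distribution Q"
    and measure_weighted_law:
      "measure Q {..a} = integral\<^sup>L M (\<lambda>\<omega>. W \<omega> * of_bool (X \<omega> \<le> a)) / integral\<^sup>L M W"
    and char_weighted_law:
      "char Q t = Complex (integral\<^sup>L M (\<lambda>\<omega>. W \<omega> * cos (t * X \<omega> + 0)) / integral\<^sup>L M W)
         (integral\<^sup>L M (\<lambda>\<omega>. W \<omega> * cos (t * X \<omega> + - pi / 2)) / integral\<^sup>L M W)"
proof -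
  note [measurable] = borel_measurable_integrable[OF int]
  define m where "m = integral\<^sup>L M W"
  have m: "m > 0" using assms(4) by (simp add: m_def)
  define D where "D = density M (\<lambda>\<omega>. W \<omega> / m)"
  have Q: "Q = distr D borel X" by (simp add: Q_def D_def m_def)
  have [measurable_cong, simp]: "sets D = sets M" by (simp add: D_def)
  have [simp]: "space D = space M" by (simp add: D_def)
  have "emeasure D (space D) = ennreal (integral\<^sup>L M (\<lambda>\<omega>. W \<omega> / m))"
    using int W m by (simp add: D_def emeasure_density nn_integral_eq_integral)
  also have "\<dots> = 1" using m by (simp add: m_def)
  finally interpret D: prob_space D by (intro prob_spaceI)
  have X: "X \<in> borel_measurable D" by simp
  show "real_distribution Q"
    unfolding Q using D.real_distribution_distr[OF X] .
  have "measure Q {..a} = measure D {\<omega> \<in> space M. X \<omega> \<le> a}"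
    unfolding Q by (subst measure_distr) (auto simp: vimage_def Int_def conj_commute)
  also have "\<dots> = integral\<^sup>L D (indicator {\<omega> \<in> space M. X \<omega> \<le> a})"
    by simp
  also have "\<dots> = integral\<^sup>L M (\<lambda>\<omega>. W \<omega> / m * indicator {\<omega> \<in> space M. X \<omega> \<le> a} \<omega>)"
    unfolding D_def using W m by (subst integral_density) auto
  also have "\<dots> = integral\<^sup>L M (\<lambda>\<omega>. (W \<omega> * of_bool (X \<omega> \<le> a)) / m)"
    by (intro Bochner_Integration.integral_cong) auto
  finally show "measure Q {..a} = integral\<^sup>L M (\<lambda>\<omega>. W \<omega> * of_bool (X \<omega> \<le> a)) / integral\<^sup>L M W"
    by (simp add: m_def)
  have i: "integrable M (\<lambda>\<omega>. (W \<omega> / m) *\<^sub>R iexp (t * X \<omega>))"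
    by (rule Bochner_Integration.integrable_bound[where f = "\<lambda>\<omega>. W \<omega> / m"])
       (use int W m in \<open>auto simp: norm_mult\<close>)
  have c: "char Q t = (CLINT \<omega>|M. (W \<omega> / m) *\<^sub>R iexp (t * X \<omega>))"
    unfolding char_def D_def Q using W m by (subst integral_distr, simp, simp, subst integral_density) auto
  have iexp: "(W \<omega> / m) *\<^sub>R iexp (t * X \<omega>) = Complex (W \<omega> * cos (t * X \<omega> + 0) / m) (W \<omega> * cos (t * X \<omega> + - pi / 2) / m)" for \<omega>
    unfolding cis_conv_exp[symmetric] by (simp add: complex_eq_iff cos_diff)
  have "Re (char Q t) = integral\<^sup>L M (\<lambda>\<omega>. W \<omega> * cos (t * X \<omega> + 0) / m)"
    unfolding c integral_Re[OF i, symmetric] unfolding iexp complex.sel by (rule refl)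
  moreover have "Im (char Q t) = integral\<^sup>L M (\<lambda>\<omega>. W \<omega> * cos (t * X \<omega> + - pi / 2) / m)"
    unfolding c integral_Im[OF i, symmetric] unfolding iexp complex.sel by (rule refl)
  ultimately show "char Q t = Complex (integral\<^sup>L M (\<lambda>\<omega>. W \<omega> * cos (t * X \<omega> + 0)) / integral\<^sup>L M W)
         (integral\<^sup>L M (\<lambda>\<omega>. W \<omega> * cos (t * X \<omega> + - pi / 2)) / integral\<^sup>L M W)"
    by (simp add: complex_eq_iff m_def)
qed

lemma integral_mult_of_bool_eq_0:
  fixes W :: "'w \<Rightarrow> real" and X :: "'w \<Rightarrow> real"
  assumes [measurable]: "X \<in> borel_measurable M" and int: "integrable M W"
    and W: "\<And>\<omega>. 0 \<le> W \<omega>" and m: "integral\<^sup>L M W = 0"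
  shows "integral\<^sup>L M (\<lambda>\<omega>. W \<omega> * of_bool (X \<omega> \<le> a)) = 0"
proof -
  note [measurable] = borel_measurable_integrable[OF int]
  have "AE \<omega> in M. W \<omega> = 0"
    using integral_nonneg_eq_0_iff_AE[OF int] W m by auto
  then have "integral\<^sup>L M (\<lambda>\<omega>. W \<omega> * of_bool (X \<omega> \<le> a)) = integral\<^sup>L M (\<lambda>\<omega>. 0)"
    by (intro integral_cong_AE) auto
  then show ?thesis by simp
qed

text \<open>Levy uniqueness for the law of \<open>X\<close> under the weight \<open>W\<close>. The case
  of total weight zero is separate because there is then nothing to normalize.\<close>

lemma weighted_distribution_eq:
  fixes W :: "'w \<Rightarrow> real" and W' :: "'v \<Rightarrow> real"
  assumes X: "X \<in> borel_measurable M" and Y: "Y \<in> borel_measurable N"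
    and W: "integrable M W" "\<And>\<omega>. 0 \<le> W \<omega>" and W': "integrable N W'" "\<And>\<omega>. 0 \<le> W' \<omega>"
    and eq: "\<And>t \<theta>. integral\<^sup>L M (\<lambda>\<omega>. W \<omega> * cos (t * X \<omega> + \<theta>))
      = integral\<^sup>L N (\<lambda>\<omega>. W' \<omega> * cos (t * Y \<omega> + \<theta>))"
  shows "integral\<^sup>L M (\<lambda>\<omega>. W \<omega> * of_bool (X \<omega> \<le> a)) = integral\<^sup>L N (\<lambda>\<omega>. W' \<omega> * of_bool (Y \<omega> \<le> a))"
proof -
  have m: "integral\<^sup>L M W = integral\<^sup>L N W'"
    using eq[of 0 0] by simp
  show ?thesis
  proof (cases "integral\<^sup>L M W = 0")
    case True
    then show ?thesis
      using integral_mult_of_bool_eq_0[OF X W] integral_mult_of_bool_eq_0[OF Y W'] m by simp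
  next
    case False
    moreover have "integral\<^sup>L M W \<ge> 0"
      using W(2) by (intro integral_nonneg_AE) auto
    ultimately have pos: "integral\<^sup>L M W > 0" "integral\<^sup>L N W' > 0"
      using m by auto
    define Q where "Q = distr (density M (\<lambda>\<omega>. W \<omega> / integral\<^sup>L M W)) borel X"
    define R where "R = distr (density N (\<lambda>\<omega>. W' \<omega> / integral\<^sup>L N W')) borel Y"
    note Q = weighted_law[OF X W pos(1), folded Q_def]
    note R = weighted_law[OF Y W' pos(2), folded R_def]
    have "char Q = char R"
      by (rule ext) (simp only: Q(3) R(3) eq m)
    with Q(1) R(1) have "Q = R"
      by (intro Levy_uniqueness)
    then have "measure Q {..a} = measure R {..a}" by simp
    then show ?thesis using pos m by (simp add: Q(2) R(2))
  qed
qed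

text \<open>The product formula for cosines expresses the transform of the law of \<open>U\<close> under
  the weight \<open>V * (1 + cos (S + \<phi>))\<close> by joint transforms of \<open>U\<close>
  and \<open>S\<close>.\<close>

lemma integral_cos_weight:
  fixes U S V :: "'w \<Rightarrow> real"
  assumes "prob_space M"
    and [measurable]: "U \<in> borel_measurable M" "S \<in> borel_measurable M" "V \<in> borel_measurable M"
    and V: "\<And>\<omega>. 0 \<le> V \<omega>" "\<And>\<omega>. V \<omega> \<le> 1"
  shows "integral\<^sup>L M (\<lambda>\<omega>. V \<omega> * (1 + cos (S \<omega> + \<phi>)) * cos (t * U \<omega> + \<theta>))
    = integral\<^sup>L M (\<lambda>\<omega>. V \<omega> * cos (t * U \<omega> + 0 * S \<omega> + \<theta>))
      + (integral\<^sup>L M (\<lambda>\<omega>. V \<omega> * cos (t * U \<omega> + 1 * S \<omega> + (\<theta> + \<phi>)))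
        + integral\<^sup>L M (\<lambda>\<omega>. V \<omega> * cos (t * U \<omega> + (- 1) * S \<omega> + (\<theta> - \<phi>)))) / 2"
proof -
  interpret prob_space M by fact
  have int: "integrable M (\<lambda>\<omega>. V \<omega> * cos (t * U \<omega> + s * S \<omega> + \<theta>))" for s \<theta>
  proof (rule integrable_const_bound[where B = 1])
    have "\<bar>V \<omega>\<bar> * \<bar>cos (t * U \<omega> + s * S \<omega> + \<theta>)\<bar> \<le> 1 * 1" for \<omega>
      using V[of \<omega>] by (intro mult_mono) auto
    then show "AE \<omega> in M. norm (V \<omega> * cos (t * U \<omega> + s * S \<omega> + \<theta>)) \<le> 1"
      by (simp add: abs_mult)
  qed simp
  have "V \<omega> * (1 + cos (S \<omega> + \<phi>)) * cos (t * U \<omega> + \<theta>)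
      = V \<omega> * cos (t * U \<omega> + 0 * S \<omega> + \<theta>)
      + (V \<omega> * cos (t * U \<omega> + 1 * S \<omega> + (\<theta> + \<phi>)) + V \<omega> * cos (t * U \<omega> + (- 1) * S \<omega> + (\<theta> - \<phi>))) / 2" for \<omega>
  proof -
    have "cos (S \<omega> + \<phi>) * cos (t * U \<omega> + \<theta>)
        = (cos (S \<omega> + \<phi> - (t * U \<omega> + \<theta>)) + cos (S \<omega> + \<phi> + (t * U \<omega> + \<theta>))) / 2"
      by (rule cos_times_cos)
    also have "S \<omega> + \<phi> + (t * U \<omega> + \<theta>) = t * U \<omega> + 1 * S \<omega> + (\<theta> + \<phi>)"
      by simp
    also have "cos (S \<omega> + \<phi> - (t * U \<omega> + \<theta>)) = cos (t * U \<omega> + (- 1) * S \<omega> + (\<theta> - \<phi>))"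
      by (subst cos_minus[symmetric]) (simp add: algebra_simps)
    finally have *: "cos (S \<omega> + \<phi>) * cos (t * U \<omega> + \<theta>)
        = (cos (t * U \<omega> + (- 1) * S \<omega> + (\<theta> - \<phi>)) + cos (t * U \<omega> + 1 * S \<omega> + (\<theta> + \<phi>))) / 2" .
    have "V \<omega> * (1 + cos (S \<omega> + \<phi>)) * cos (t * U \<omega> + \<theta>)
        = V \<omega> * cos (t * U \<omega> + \<theta>) + V \<omega> * (cos (S \<omega> + \<phi>) * cos (t * U \<omega> + \<theta>))"
      by (simp add: distrib_left distrib_right mult.assoc)
    then show ?thesis unfolding * by (simp add: distrib_left add_divide_distrib)
  qed
  then show ?thesis
    using int[of 0] int[of 1] int[of "-1"] by simp
qed

text \<open>The inversion step for one coordinate. A factor \<open>cos (S + \<phi>)\<close> has no sign,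
  so it cannot be a weight; \<open>1 + cos (S + \<phi>)\<close> can, and subtracting the
  result for the weight \<open>V\<close> alone leaves the cosine.\<close>

lemma restrict_one_coordinate:
  fixes U S V :: "'w \<Rightarrow> real" and U' S' V' :: "'v \<Rightarrow> real"
  assumes M: "prob_space M" "U \<in> borel_measurable M" "S \<in> borel_measurable M" "V \<in> borel_measurable M"
    and V: "\<And>\<omega>. 0 \<le> V \<omega>" "\<And>\<omega>. V \<omega> \<le> 1"
    and N: "prob_space N" "U' \<in> borel_measurable N" "S' \<in> borel_measurable N" "V' \<in> borel_measurable N"
    and V': "\<And>\<omega>. 0 \<le> V' \<omega>" "\<And>\<omega>. V' \<omega> \<le> 1"
    and eq: "\<And>t s \<theta>. integral\<^sup>L M (\<lambda>\<omega>. V \<omega> * cos (t * U \<omega> + s * S \<omega> + \<theta>))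
      = integral\<^sup>L N (\<lambda>\<omega>. V' \<omega> * cos (t * U' \<omega> + s * S' \<omega> + \<theta>))"
  shows "integral\<^sup>L M (\<lambda>\<omega>. V \<omega> * of_bool (U \<omega> \<le> a) * cos (S \<omega> + \<phi>))
    = integral\<^sup>L N (\<lambda>\<omega>. V' \<omega> * of_bool (U' \<omega> \<le> a) * cos (S' \<omega> + \<phi>))"
proof -
  have bnd: "integrable P W \<and> integrable P (\<lambda>\<omega>. W \<omega> * (1 + cos (R \<omega> + \<phi>)))"
    if P: "prob_space P" and [measurable]: "R \<in> borel_measurable P" "W \<in> borel_measurable P"
      and W: "\<And>\<omega>. 0 \<le> W \<omega>" "\<And>\<omega>. W \<omega> \<le> 1" for P :: "'p measure" and R W :: "'p \<Rightarrow> real"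
  proof -
    interpret prob_space P by fact
    have "\<bar>W \<omega>\<bar> * \<bar>1 + cos (R \<omega> + \<phi>)\<bar> \<le> 1 * 2" for \<omega>
    proof (intro mult_mono)
      show "\<bar>1 + cos (R \<omega> + \<phi>)\<bar> \<le> 2"
        using cos_le_one[of "R \<omega> + \<phi>"] cos_ge_minus_one[of "R \<omega> + \<phi>"] by linarith
    qed (use W in auto)
    then have "integrable P (\<lambda>\<omega>. W \<omega> * (1 + cos (R \<omega> + \<phi>)))"
      by (intro integrable_const_bound[where B = 2]) (auto simp: abs_mult)
    moreover have "integrable P W"
      using W by (intro integrable_const_bound[where B = 1]) auto
    ultimately show ?thesis by simp
  qed
  have nonneg: "0 \<le> 1 + cos x" for x :: real
    using cos_ge_minus_one[of x] by linarith
  have plain: "integral\<^sup>L M (\<lambda>\<omega>. V \<omega> * of_bool (U \<omega> \<le> a)) = integral\<^sup>L N (\<lambda>\<omega>. V' \<omega> * of_bool (U' \<omega> \<le> a))"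
    by (rule weighted_distribution_eq[OF M(2) N(2)])
       (use bnd[OF M(1,3,4) V] bnd[OF N(1,3,4) V'] V V' eq[of _ 0] in auto)
  have tilted: "integral\<^sup>L M (\<lambda>\<omega>. V \<omega> * (1 + cos (S \<omega> + \<phi>)) * of_bool (U \<omega> \<le> a))
      = integral\<^sup>L N (\<lambda>\<omega>. V' \<omega> * (1 + cos (S' \<omega> + \<phi>)) * of_bool (U' \<omega> \<le> a))"
  proof (rule weighted_distribution_eq[OF M(2) N(2)])
    show "integral\<^sup>L M (\<lambda>\<omega>. V \<omega> * (1 + cos (S \<omega> + \<phi>)) * cos (t * U \<omega> + \<theta>))
      = integral\<^sup>L N (\<lambda>\<omega>. V' \<omega> * (1 + cos (S' \<omega> + \<phi>)) * cos (t * U' \<omega> + \<theta>))" for t \<theta>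
      by (simp only: integral_cos_weight[OF M V] integral_cos_weight[OF N V'] eq)
  qed (use bnd[OF M(1,3,4) V] bnd[OF N(1,3,4) V'] V V' nonneg in auto)
  have split: "integral\<^sup>L P (\<lambda>\<omega>. W \<omega> * of_bool (Q \<omega> \<le> a) * cos (R \<omega> + \<phi>))
      = integral\<^sup>L P (\<lambda>\<omega>. W \<omega> * (1 + cos (R \<omega> + \<phi>)) * of_bool (Q \<omega> \<le> a))
        - integral\<^sup>L P (\<lambda>\<omega>. W \<omega> * of_bool (Q \<omega> \<le> a))"
    if P: "prob_space P" and [measurable]: "Q \<in> borel_measurable P" "R \<in> borel_measurable P" "W \<in> borel_measurable P"
      and W: "\<And>\<omega>. 0 \<le> W \<omega>" "\<And>\<omega>. W \<omega> \<le> 1" for P :: "'p measure" and Q R W :: "'p \<Rightarrow> real"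
  proof -
    have "integrable P (\<lambda>\<omega>. W \<omega> * (1 + cos (R \<omega> + \<phi>)) * of_bool (Q \<omega> \<le> a))"
      by (rule Bochner_Integration.integrable_bound[where f = "\<lambda>\<omega>. W \<omega> * (1 + cos (R \<omega> + \<phi>))"])
         (use bnd[OF P that(3,4) W] in auto)
    moreover have "integrable P (\<lambda>\<omega>. W \<omega> * of_bool (Q \<omega> \<le> a))"
      by (rule Bochner_Integration.integrable_bound[where f = W])
         (use bnd[OF P that(3,4) W] in auto)
    ultimately show ?thesis
      by (subst Bochner_Integration.integral_diff[symmetric])
         (auto intro!: Bochner_Integration.integral_cong simp: algebra_simps)
  qed
  show ?thesis
    unfolding split[OF M V] split[OF N V'] plain tilted ..
qed

text \<open>Interpolates between the joint characteristic function (\<open>A = {}\<close>) and the joint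
  distribution function (\<open>A = J\<close>). Coordinates move one at a time from the cosine
  to the indicator, which reduces multivariate uniqueness to the univariate theorem.\<close>

lemma gaussian_orthant_cos_eq:
  assumes X: "centered_gaussian_process M I X C" and Y: "centered_gaussian_process N I Y C"
    and J: "finite J" "J \<subseteq> I" and A: "A \<subseteq> J"
  shows "integral\<^sup>L M (\<lambda>\<omega>. of_bool (\<forall>j\<in>A. X j \<omega> \<le> a) * cos ((\<Sum>j\<in>J - A. c j * X j \<omega>) + \<theta>))
    = integral\<^sup>L N (\<lambda>\<omega>. of_bool (\<forall>j\<in>A. Y j \<omega> \<le> a) * cos ((\<Sum>j\<in>J - A. c j * Y j \<omega>) + \<theta>))"
  using finite_subset[OF A J(1)] A
proof (induction A arbitrary: c \<theta> rule: finite_induct)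
  case empty
  then show ?case using gaussian_cos_expectation_eq[OF X Y J] by simp
next
  case (insert k A)
  have XM: "X j \<in> borel_measurable M" and YN: "Y j \<in> borel_measurable N" if "j \<in> J" for j
    using gaussian_process_measurable[OF X] gaussian_process_measurable[OF Y] J that by auto
  have k: "k \<in> J" and A: "A \<subseteq> J" using insert by auto
  have J_A: "J - A = insert k (J - insert k A)" using insert by auto
  have meas: "(\<lambda>\<omega>. \<Sum>j\<in>J - insert k A. c j * F j \<omega>) \<in> borel_measurable P"
      "(\<lambda>\<omega>. of_bool (\<forall>j\<in>A. F j \<omega> \<le> a) :: real) \<in> borel_measurable P"
    if F: "\<And>j. j \<in> J \<Longrightarrow> F j \<in> borel_measurable P" for F :: "_ \<Rightarrow> 'p \<Rightarrow> real" and P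
  proof -
    have [measurable]: "j \<in> J - insert k A \<Longrightarrow> F j \<in> borel_measurable P"
      "j \<in> A \<Longrightarrow> F j \<in> borel_measurable P" for j
      using F A by auto
    show "(\<lambda>\<omega>. \<Sum>j\<in>J - insert k A. c j * F j \<omega>) \<in> borel_measurable P"
      by measurable
    have [measurable]: "Measurable.pred P (\<lambda>\<omega>. \<forall>j\<in>A. F j \<omega> \<le> a)"
      using insert(1) by (intro pred_intros_finite) measurable
    show "(\<lambda>\<omega>. of_bool (\<forall>j\<in>A. F j \<omega> \<le> a) :: real) \<in> borel_measurable P"
      by measurable
  qed
  have "integral\<^sup>L M (\<lambda>\<omega>. of_bool (\<forall>j\<in>A. X j \<omega> \<le> a) * of_bool (X k \<omega> \<le> a) *
        cos ((\<Sum>j\<in>J - insert k A. c j * X j \<omega>) + \<theta>))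
      = integral\<^sup>L N (\<lambda>\<omega>. of_bool (\<forall>j\<in>A. Y j \<omega> \<le> a) * of_bool (Y k \<omega> \<le> a) *
        cos ((\<Sum>j\<in>J - insert k A. c j * Y j \<omega>) + \<theta>))"
  proof (rule restrict_one_coordinate)
    fix t s \<theta>
    \<comment> \<open>The frequency of the coordinate that is about to be restricted varies freely.\<close>
    let ?d = "\<lambda>j. if j = k then t else s * c j"
    have sum: "(\<Sum>j\<in>J - A. ?d j * F j) = t * F k + s * (\<Sum>j\<in>J - insert k A. c j * F j)" for F
      unfolding J_A using J by (subst sum.insert) (auto simp: sum_distrib_left mult.assoc intro!: sum.cong)
    show "integral\<^sup>L M (\<lambda>\<omega>. of_bool (\<forall>j\<in>A. X j \<omega> \<le> a) *
            cos (t * X k \<omega> + s * (\<Sum>j\<in>J - insert k A. c j * X j \<omega>) + \<theta>))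
        = integral\<^sup>L N (\<lambda>\<omega>. of_bool (\<forall>j\<in>A. Y j \<omega> \<le> a) *
            cos (t * Y k \<omega> + s * (\<Sum>j\<in>J - insert k A. c j * Y j \<omega>) + \<theta>))"
      using insert.IH[OF A, of ?d \<theta>] unfolding sum .
  qed (use gaussian_process_prob_space[OF X] gaussian_process_prob_space[OF Y] XM[OF k] YN[OF k]
        meas[of X, OF XM] meas[of Y, OF YN] in auto)
  then show ?case
    by (simp add: of_bool_conj mult.commute)
qed

lemma gaussian_orthant_prob_eq:
  assumes X: "centered_gaussian_process M I X C" and Y: "centered_gaussian_process N I Y C"
    and J: "finite J" "J \<subseteq> I"
  shows "measure M {\<omega>\<in>space M. \<forall>j\<in>J. X j \<omega> \<le> a} = measure N {\<omega>\<in>space N. \<forall>j\<in>J. Y j \<omega> \<le> a}"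
proof -
  have prob: "measure P {\<omega>\<in>space P. \<forall>j\<in>J. F j \<omega> \<le> a} = integral\<^sup>L P (\<lambda>\<omega>. of_bool (\<forall>j\<in>J. F j \<omega> \<le> a))"
    if "centered_gaussian_process P I F C" for P :: "'p measure" and F
  proof -
    interpret prob_space P using that by (rule gaussian_process_prob_space)
    have "integral\<^sup>L P (\<lambda>\<omega>. of_bool (\<forall>j\<in>J. F j \<omega> \<le> a)) = integral\<^sup>L P (indicator {\<omega>\<in>space P. \<forall>j\<in>J. F j \<omega> \<le> a})"
      by (intro Bochner_Integration.integral_cong) (auto simp: indicator_def)
    also have "\<dots> = measure P ({\<omega>\<in>space P. \<forall>j\<in>J. F j \<omega> \<le> a} \<inter> space P)"
      by (rule Bochner_Integration.integral_indicator)
    also have "{\<omega>\<in>space P. \<forall>j\<in>J. F j \<omega> \<le> a} \<inter> space P = {\<omega>\<in>space P. \<forall>j\<in>J. F j \<omega> \<le> a}"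
      by auto
    finally show ?thesis ..
  qed
  show ?thesis
    using gaussian_orthant_cos_eq[OF X Y J order_refl, of a "\<lambda>_. 0" 0]
    by (simp add: prob[OF X] prob[OF Y])
qed

section \<open>Events that depend on a whole path\<close>

lemma dense_le_imp_le:
  fixes f :: "'a::metric_space \<Rightarrow> real"
  assumes f: "continuous_on S f" and D: "D \<subseteq> S" "S \<subseteq> closure D" and le: "\<And>x. x \<in> D \<Longrightarrow> f x \<le> a"
    and x: "x \<in> S"
  shows "f x \<le> a"
proof -
  have "x \<in> closure D" using D(2) x by blast
  then obtain u where u: "\<And>n. u n \<in> D" "u \<longlonglongrightarrow> x"
    unfolding closure_sequential by blast
  have "(\<lambda>n. f (u n)) \<longlonglongrightarrow> f x"
    using f u D(1) x unfolding continuous_on_sequentially comp_def by blast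
  then show ?thesis
    by (rule LIMSEQ_le_const2) (use u le in auto)
qed

text \<open>For continuous paths, a bound on the whole of \<open>S\<close> is a bound along a dense
  sequence, so the event is a decreasing limit of events that involve finitely many times.\<close>

lemma path_le_limit:
  fixes X :: "'i::metric_space \<Rightarrow> 'w \<Rightarrow> real" and d :: "nat \<Rightarrow> 'i"
  assumes X: "centered_gaussian_process M I X C" and S: "S \<subseteq> I"
    and cont: "\<And>\<omega>. \<omega> \<in> space M \<Longrightarrow> continuous_on S (\<lambda>t. X t \<omega>)"
    and d: "range d \<subseteq> S" "S \<subseteq> closure (range d)"
  shows sets_path_le_of_dense: "{\<omega>\<in>space M. \<forall>t\<in>S. X t \<omega> \<le> a} \<in> sets M"
    and prob_path_le_limit: "(\<lambda>n. measure M {\<omega>\<in>space M. \<forall>t\<in>d ` {..n}. X t \<omega> \<le> a})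
      \<longlonglongrightarrow> measure M {\<omega>\<in>space M. \<forall>t\<in>S. X t \<omega> \<le> a}"
proof -
  interpret prob_space M using X by (rule gaussian_process_prob_space)
  define E where "E n = {\<omega>\<in>space M. \<forall>t\<in>d ` {..n}. X t \<omega> \<le> a}" for n
  have [measurable]: "X (d i) \<in> borel_measurable M" for i
    using d(1) S by (intro gaussian_process_measurable[OF X]) auto
  have E: "E n \<in> sets M" for n
    unfolding E_def by simp
  have eq: "{\<omega>\<in>space M. \<forall>t\<in>S. X t \<omega> \<le> a} = (\<Inter>n. E n)"
  proof (intro equalityI subsetI)
    fix \<omega> assume \<omega>: "\<omega> \<in> (\<Inter>n. E n)"
    then have "\<omega> \<in> space M" and "X (d n) \<omega> \<le> a" for n
      unfolding E_def by auto
    then show "\<omega> \<in> {\<omega>\<in>space M. \<forall>t\<in>S. X t \<omega> \<le> a}"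
      using dense_le_imp_le[OF cont d, of \<omega> a] by auto
  qed (use d(1) in \<open>auto simp: E_def\<close>)
  show "{\<omega>\<in>space M. \<forall>t\<in>S. X t \<omega> \<le> a} \<in> sets M"
    unfolding eq using E by blast
  have "decseq E"
    by (rule decseq_SucI) (auto simp: E_def)
  then have "(\<lambda>n. measure M (E n)) \<longlonglongrightarrow> measure M (\<Inter>n. E n)"
    using E by (intro finite_Lim_measure_decseq) auto
  then show "(\<lambda>n. measure M {\<omega>\<in>space M. \<forall>t\<in>d ` {..n}. X t \<omega> \<le> a})
      \<longlonglongrightarrow> measure M {\<omega>\<in>space M. \<forall>t\<in>S. X t \<omega> \<le> a}"
    unfolding eq unfolding E_def .
qed

lemma dense_sequence:
  fixes S :: "'i::{metric_space, second_countable_topology} set"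
  assumes "S \<noteq> {}"
  obtains d :: "nat \<Rightarrow> 'i" where "range d \<subseteq> S" "S \<subseteq> closure (range d)"
proof -
  obtain D where D: "countable D" "D \<subseteq> S" "S \<subseteq> closure D"
    by (rule separable)
  have "D \<noteq> {}" using D assms by auto
  then have "range (from_nat_into D) = D"
    using D(1) by (rule range_from_nat_into)
  then show thesis using D by (intro that[of "from_nat_into D"]) auto
qed

lemma sets_path_le:
  fixes X :: "'i::{metric_space, second_countable_topology} \<Rightarrow> 'w \<Rightarrow> real"
  assumes X: "centered_gaussian_process M I X C" and S: "S \<subseteq> I" "S \<noteq> {}"
    and X_cont: "\<And>\<omega>. \<omega> \<in> space M \<Longrightarrow> continuous_on S (\<lambda>t. X t \<omega>)"
  shows "{\<omega>\<in>space M. \<forall>t\<in>S. X t \<omega> \<le> a} \<in> sets M"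
proof -
  obtain d :: "nat \<Rightarrow> 'i" where d: "range d \<subseteq> S" "S \<subseteq> closure (range d)"
    using S(2) by (rule dense_sequence)
  show ?thesis by (rule sets_path_le_of_dense[OF X S(1) X_cont d])
qed

lemma prob_path_le_eq:
  fixes X :: "'i::{metric_space, second_countable_topology} \<Rightarrow> 'w \<Rightarrow> real"
  assumes X: "centered_gaussian_process M I X C" and Y: "centered_gaussian_process N I Y C"
    and S: "S \<subseteq> I" "S \<noteq> {}"
    and X_cont: "\<And>\<omega>. \<omega> \<in> space M \<Longrightarrow> continuous_on S (\<lambda>t. X t \<omega>)"
    and Y_cont: "\<And>\<omega>. \<omega> \<in> space N \<Longrightarrow> continuous_on S (\<lambda>t. Y t \<omega>)"
  shows "measure M {\<omega>\<in>space M. \<forall>t\<in>S. X t \<omega> \<le> a} = measure N {\<omega>\<in>space N. \<forall>t\<in>S. Y t \<omega> \<le> a}"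
proof -
  obtain d :: "nat \<Rightarrow> 'i" where d: "range d \<subseteq> S" "S \<subseteq> closure (range d)"
    using S(2) by (rule dense_sequence)
  have "measure M {\<omega>\<in>space M. \<forall>t\<in>d ` {..n}. X t \<omega> \<le> a}
      = measure N {\<omega>\<in>space N. \<forall>t\<in>d ` {..n}. Y t \<omega> \<le> a}" for n
    using d(1) S(1) by (intro gaussian_orthant_prob_eq[OF X Y]) auto
  then show ?thesis
    using prob_path_le_limit[OF X S(1) X_cont d, of a] prob_path_le_limit[OF Y S(1) Y_cont d, of a]
    by (simp add: LIMSEQ_unique)
qed

text \<open>On a compact set a continuous path that stays below zero stays below some \<open>- 1 / (n +
  1)\<close>; strict negativity is thus an increasing limit of closed conditions.\<close>

lemma path_less_limit:
  fixes X :: "'i::{metric_space, second_countable_topology} \<Rightarrow> 'w \<Rightarrow> real"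
  assumes X: "centered_gaussian_process M I X C" and S: "S \<subseteq> I" "S \<noteq> {}" "compact S"
    and cont: "\<And>\<omega>. \<omega> \<in> space M \<Longrightarrow> continuous_on S (\<lambda>t. X t \<omega>)"
  shows sets_path_less: "{\<omega>\<in>space M. \<forall>t\<in>S. X t \<omega> < 0} \<in> sets M"
    and prob_path_less_limit: "(\<lambda>n. measure M {\<omega>\<in>space M. \<forall>t\<in>S. X t \<omega> \<le> - inverse (real (Suc n))})
      \<longlonglongrightarrow> measure M {\<omega>\<in>space M. \<forall>t\<in>S. X t \<omega> < 0}"
proof -
  interpret prob_space M using X by (rule gaussian_process_prob_space)
  define E where "E n = {\<omega>\<in>space M. \<forall>t\<in>S. X t \<omega> \<le> - inverse (real (Suc n))}" for n
  have E: "E n \<in> sets M" for n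
    unfolding E_def using sets_path_le[OF X S(1,2) cont] .
  have eq: "{\<omega>\<in>space M. \<forall>t\<in>S. X t \<omega> < 0} = (\<Union>n. E n)"
  proof (intro equalityI subsetI)
    fix \<omega> assume \<omega>: "\<omega> \<in> {\<omega>\<in>space M. \<forall>t\<in>S. X t \<omega> < 0}"
    then obtain s where s: "s \<in> S" "\<forall>t\<in>S. X t \<omega> \<le> X s \<omega>"
      using continuous_attains_sup[OF S(3,2) cont[of \<omega>]] by auto
    then obtain n where "inverse (real (Suc n)) < - X s \<omega>"
      using \<omega> reals_Archimedean[of "- X s \<omega>"] by auto
    then have "\<omega> \<in> E n"
      using s \<omega> unfolding E_def by force
    then show "\<omega> \<in> (\<Union>n. E n)" by blast
  next
    fix \<omega> assume "\<omega> \<in> (\<Union>n. E n)"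
    then obtain n where n: "\<omega> \<in> E n" by blast
    then have "X t \<omega> < 0" if "t \<in> S" for t
      using le_less_trans[of "X t \<omega>" "- inverse (real (Suc n))" 0] that unfolding E_def by simp
    with n show "\<omega> \<in> {\<omega>\<in>space M. \<forall>t\<in>S. X t \<omega> < 0}"
      unfolding E_def by simp
  qed
  show "{\<omega>\<in>space M. \<forall>t\<in>S. X t \<omega> < 0} \<in> sets M"
    unfolding eq using E by blast
  have "incseq E"
  proof (rule incseq_SucI)
    fix n
    have "- inverse (real (Suc n)) \<le> - inverse (real (Suc (Suc n)))"
      by (simp add: field_simps)
    then show "E n \<subseteq> E (Suc n)"
      unfolding E_def by (auto simp del: of_nat_Suc intro: order_trans)
  qed
  then have "(\<lambda>n. measure M (E n)) \<longlonglongrightarrow> measure M (\<Union>n. E n)"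
    using E by (intro finite_Lim_measure_incseq) auto
  then show "(\<lambda>n. measure M {\<omega>\<in>space M. \<forall>t\<in>S. X t \<omega> \<le> - inverse (real (Suc n))})
      \<longlonglongrightarrow> measure M {\<omega>\<in>space M. \<forall>t\<in>S. X t \<omega> < 0}"
    unfolding eq unfolding E_def .
qed

lemma prob_path_less_eq:
  fixes X :: "'i::{metric_space, second_countable_topology} \<Rightarrow> 'w \<Rightarrow> real"
  assumes X: "centered_gaussian_process M I X C" and Y: "centered_gaussian_process N I Y C"
    and S: "S \<subseteq> I" "S \<noteq> {}" "compact S"
    and X_cont: "\<And>\<omega>. \<omega> \<in> space M \<Longrightarrow> continuous_on S (\<lambda>t. X t \<omega>)"
    and Y_cont: "\<And>\<omega>. \<omega> \<in> space N \<Longrightarrow> continuous_on S (\<lambda>t. Y t \<omega>)"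
  shows "measure M {\<omega>\<in>space M. \<forall>t\<in>S. X t \<omega> < 0} = measure N {\<omega>\<in>space N. \<forall>t\<in>S. Y t \<omega> < 0}"
  using prob_path_less_limit[OF X S X_cont] prob_path_less_limit[OF Y S Y_cont]
  by (simp add: prob_path_le_eq[OF X Y S(1,2) X_cont Y_cont] LIMSEQ_unique)

text \<open>Covers the time change and normalization of the heat field, its restriction to a spatial
  segment, and the reflection \<open>X \<mapsto> - X\<close>.\<close>

lemma gaussian_process_reparam:
  assumes X: "centered_gaussian_process M I X C" and g: "inj_on g I'" "g ` I' \<subseteq> I"
    and C': "\<And>s t. s \<in> I' \<Longrightarrow> t \<in> I' \<Longrightarrow> a s * a t * C (g s) (g t) = C' s t"
  shows "centered_gaussian_process M I' (\<lambda>t \<omega>. a t * X (g t) \<omega>) C'"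
  unfolding centered_gaussian_process_def
proof (intro conjI allI impI ballI)
  show "prob_space M" using X by (rule gaussian_process_prob_space)
next
  fix J and c :: "_ \<Rightarrow> real" assume J: "finite J" "J \<subseteq> I'"
  define h where "h = inv_into I' g"
  have h: "h (g j) = j" if "j \<in> J" for j
    unfolding h_def using that J g by (auto intro: inv_into_f_f)
  have "centered_normal M (\<lambda>\<omega>. \<Sum>k\<in>g ` J. (c (h k) * a (h k)) * X k \<omega>)"
    using J g by (intro gaussian_process_sum_normal[OF X]) auto
  also have "(\<lambda>\<omega>. \<Sum>k\<in>g ` J. (c (h k) * a (h k)) * X k \<omega>) = (\<lambda>\<omega>. \<Sum>j\<in>J. c j * (a j * X (g j) \<omega>))"
    using J g h by (subst sum.reindex) (auto intro: inj_on_subset simp: mult.assoc)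
  finally show "centered_normal M (\<lambda>\<omega>. \<Sum>j\<in>J. c j * (a j * X (g j) \<omega>))" .
next
  fix s t assume st: "s \<in> I'" "t \<in> I'"
  have "prob_space.expectation M (\<lambda>\<omega>. a s * X (g s) \<omega> * (a t * X (g t) \<omega>))
      = prob_space.expectation M (\<lambda>\<omega>. (a s * a t) * (X (g s) \<omega> * X (g t) \<omega>))"
    by (simp add: mult_ac)
  also have "\<dots> = a s * a t * C (g s) (g t)"
    using gaussian_process_cov[OF X, of "g s" "g t"] st g(2) by auto
  finally show "prob_space.expectation M (\<lambda>\<omega>. a s * X (g s) \<omega> * (a t * X (g t) \<omega>)) = C' s t"
    using C'[OF st] by simp
qed

text \<open>By the intermediate value theorem a path without zeros has constant sign, and both signs are
  equally likely because \<open>- X\<close> has the covariance of \<open>X\<close>; hence the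
  factor two.\<close>

lemma prob_path_nonzero_eq:
  fixes X :: "real \<Rightarrow> 'w \<Rightarrow> real"
  assumes X: "centered_gaussian_process M I X C" and Y: "centered_gaussian_process N I Y C"
    and S: "{0..T} \<subseteq> I" "0 \<le> T"
    and X_cont: "\<And>\<omega>. \<omega> \<in> space M \<Longrightarrow> continuous_on {0..T} (\<lambda>t. X t \<omega>)"
    and Y_cont: "\<And>\<omega>. \<omega> \<in> space N \<Longrightarrow> continuous_on {0..T} (\<lambda>t. Y t \<omega>)"
  shows "measure M {\<omega>\<in>space M. \<forall>t\<in>{0..T}. X t \<omega> \<noteq> 0}
    = 2 * measure N {\<omega>\<in>space N. \<forall>t\<in>{0..T}. Y t \<omega> < 0}"
proof -
  interpret prob_space M using X by (rule gaussian_process_prob_space)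
  have S': "{0..T} \<noteq> {}" "compact {0..T}" using S by auto
  have X': "centered_gaussian_process M I (\<lambda>t \<omega>. - 1 * X t \<omega>) C"
    by (rule gaussian_process_reparam[OF X, of "\<lambda>t. t"]) auto
  have X'_cont: "continuous_on {0..T} (\<lambda>t. - 1 * X t \<omega>)" if "\<omega> \<in> space M" for \<omega>
    using X_cont[OF that] by (intro continuous_intros)
  let ?A = "{\<omega>\<in>space M. \<forall>t\<in>{0..T}. X t \<omega> < 0}" and ?B = "{\<omega>\<in>space M. \<forall>t\<in>{0..T}. - 1 * X t \<omega> < 0}"
  have "{\<omega>\<in>space M. \<forall>t\<in>{0..T}. X t \<omega> \<noteq> 0} = ?A \<union> ?B"
  proof (intro equalityI subsetI)
    fix \<omega> assume \<omega>: "\<omega> \<in> {\<omega>\<in>space M. \<forall>t\<in>{0..T}. X t \<omega> \<noteq> 0}"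
    have conn: "connected ((\<lambda>t. X t \<omega>) ` {0..T})"
      using X_cont \<omega> by (intro connected_continuous_image) auto
    have same_sign: False if "s \<in> {0..T}" "t \<in> {0..T}" "X s \<omega> < 0" "X t \<omega> > 0" for s t
    proof -
      have "0 \<in> (\<lambda>t. X t \<omega>) ` {0..T}"
        using connectedD_interval[OF conn, of "X s \<omega>" "X t \<omega>" 0] that by auto
      then show False using \<omega> by auto
    qed
    have ne: "X t \<omega> \<noteq> 0" if "t \<in> {0..T}" for t using \<omega> that by blast
    have 0: "0 \<in> {0..T}" using S by simp
    from ne[OF 0] consider "X 0 \<omega> < 0" | "X 0 \<omega> > 0" by linarith
    then show "\<omega> \<in> ?A \<union> ?B"
    proof cases
      case 1
      then have "X t \<omega> < 0" if "t \<in> {0..T}" for t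
        using same_sign[OF 0 that 1] ne[OF that] by (meson linorder_neqE_linordered_idom)
      then show ?thesis using \<omega> by blast
    next
      case 2
      then have "- 1 * X t \<omega> < 0" if "t \<in> {0..T}" for t
        using same_sign[OF that 0 _ 2] ne[OF that] by (simp add: linorder_neq_iff) blast
      then show ?thesis using \<omega> by blast
    qed
  qed auto
  moreover have "?A \<inter> ?B = {}"
    using S by (auto dest!: bspec[where x = 0])
  ultimately have "measure M {\<omega>\<in>space M. \<forall>t\<in>{0..T}. X t \<omega> \<noteq> 0} = measure M ?A + measure M ?B"
    using sets_path_less[OF X S(1) S' X_cont] sets_path_less[OF X' S(1) S' X'_cont]
    by (simp add: finite_measure_Union)
  then show ?thesis
    using prob_path_less_eq[OF X Y S(1) S' X_cont Y_cont] prob_path_less_eq[OF X' Y S(1) S' X'_cont Y_cont]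
    by simp
qed

section \<open>Smooth paths do not touch zero from below\<close>

lemma normal_small_ball:
  assumes M: "prob_space M" and X: "centered_normal M X"
    and var: "prob_space.expectation M (\<lambda>\<omega>. (X \<omega>)\<^sup>2) = 1" and \<epsilon>: "0 \<le> \<epsilon>"
  shows "measure M {\<omega>\<in>space M. \<bar>X \<omega>\<bar> \<le> \<epsilon>} \<le> 2 * \<epsilon>"
proof -
  interpret prob_space M by fact
  from M X show ?thesis
  proof (cases rule: centered_normal_cases)
    case 1
    then show ?thesis using var by simp
  next
    case (2 \<sigma>)
    then have "\<sigma> = 1" using var by (simp add: power2_eq_1_iff)
    then have D: "distributed M lborel X std_normal_density" using 2 by simp
    have "std_normal_density x \<le> 1" for x
    proof -
      have "1 \<le> sqrt (2 * pi)" using pi_gt3 by simp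
      moreover have "exp (- x\<^sup>2 / 2) \<le> 1" by simp
      ultimately have "exp (- x\<^sup>2 / 2) \<le> 1 * sqrt (2 * pi)" by linarith
      then show ?thesis
        by (simp add: std_normal_density_def divide_le_eq)
    qed
    then have le: "ennreal (std_normal_density x) * indicator {-\<epsilon>..\<epsilon>} x \<le> indicator {-\<epsilon>..\<epsilon>} x" for x
      by (auto simp: indicator_def)
    have "emeasure M (X -` {-\<epsilon>..\<epsilon>} \<inter> space M) = (\<integral>\<^sup>+x. ennreal (std_normal_density x) * indicator {-\<epsilon>..\<epsilon>} x \<partial>lborel)"
      by (rule distributed_emeasure[OF D]) simp
    also have "\<dots> \<le> (\<integral>\<^sup>+x. indicator {-\<epsilon>..\<epsilon>} x \<partial>lborel)"
      by (intro nn_integral_mono le)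
    also have "\<dots> = ennreal (2 * \<epsilon>)" using \<epsilon> by simp
    finally have "measure M (X -` {-\<epsilon>..\<epsilon>} \<inter> space M) \<le> 2 * \<epsilon>"
      using \<epsilon> by (simp add: emeasure_eq_measure)
    also have "X -` {-\<epsilon>..\<epsilon>} \<inter> space M = {\<omega>\<in>space M. \<bar>X \<omega>\<bar> \<le> \<epsilon>}"
      by (auto simp: abs_le_iff)
    finally show ?thesis .
  qed
qed

text \<open>At an interior maximum the derivative vanishes, so Taylor's bound leaves a quadratic term.
  The constant is a natural number so that the exceptional events can be collected in a
  countable union.\<close>

lemma C_infinity_touches_quadratically:
  fixes f :: "real \<Rightarrow> real"
  assumes f: "C_infinity_on f UNIV" and t: "0 < t" "t < T"
    and max: "f t = 0" "\<And>s. s \<in> {0..T} \<Longrightarrow> f s \<le> 0"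
  obtains K :: nat where "\<And>s. s \<in> {0..T} \<Longrightarrow> \<bar>f s\<bar> \<le> real K * (s - t)\<^sup>2"
proof -
  define f' where "f' x = frechet_derivative f (at x) 1" for x
  define f'' where "f'' x = frechet_derivative f' (at x) 1" for x
  have deriv: "(g has_real_derivative frechet_derivative g (at x) 1) (at x)"
    if "g differentiable (at x)" for g :: "real \<Rightarrow> real" and x
  proof -
    have g: "(g has_derivative frechet_derivative g (at x)) (at x)"
      using that by (simp add: frechet_derivative_works)
    have "frechet_derivative g (at x) h = frechet_derivative g (at x) 1 * h" for h
      using linear_cmul[OF has_derivative_linear[OF g], of h 1] by (simp add: mult.commute)
    then have "frechet_derivative g (at x) = (*) (frechet_derivative g (at x) 1)"
      by (rule ext)
    with g show ?thesis unfolding has_field_derivative_def by metis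
  qed
  have "n_times_differentiable_on (Suc (Suc 0)) f UNIV"
    using f unfolding C_infinity_on_def by blast
  then have diff1: "\<forall>x. f differentiable (at x)"
    and "\<forall>v. n_times_differentiable_on (Suc 0) (\<lambda>x. frechet_derivative f (at x) v) UNIV"
    by simp_all
  then have "n_times_differentiable_on (Suc 0) f' UNIV"
    unfolding f'_def by blast
  then have diff2: "\<forall>x. f' differentiable (at x)"
    and "\<forall>v. n_times_differentiable_on 0 (\<lambda>x. frechet_derivative f' (at x) v) UNIV"
    by simp_all
  then have "n_times_differentiable_on 0 f'' UNIV"
    unfolding f''_def by blast
  then have f''_cont: "continuous_on UNIV f''" by simp
  have f': "(f has_real_derivative f' x) (at x)" and f'': "(f' has_real_derivative f'' x) (at x)" for x
    using deriv[OF diff1[rule_format, of x]] deriv[OF diff2[rule_format, of x]]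
    unfolding f'_def f''_def .
  have "f' t = 0"
    by (rule DERIV_local_max[OF f', of "min t (T - t)"])
       (use t max in \<open>auto simp: abs_less_iff\<close>)
  have "compact (f'' ` {0..T})"
    using f''_cont by (intro compact_continuous_image) (auto intro: continuous_on_subset)
  then have "\<exists>B. \<forall>x\<in>{0..T}. \<bar>f'' x\<bar> \<le> B"
    by (auto simp: bounded_iff dest!: compact_imp_bounded)
  then obtain B where B: "\<And>x. x \<in> {0..T} \<Longrightarrow> \<bar>f'' x\<bar> \<le> B"
    by blast
  obtain K :: nat where K: "B \<le> real K" using real_arch_simple by blast
  have slope: "\<bar>f' x\<bar> \<le> real K * \<bar>x - t\<bar>" if "x \<in> {0..T}" for x
proof -
    have "norm (f' x - f' t) \<le> real K * norm (x - t)"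
    proof (rule field_differentiable_bound[of "{0..T}"])
      fix z assume "z \<in> {0..T}"
      then show "norm (f'' z) \<le> real K" using B[of z] K by simp
      show "(f' has_real_derivative f'' z) (at z within {0..T})"
        using f'' by (rule has_field_derivative_at_within)
    qed (use that t in auto)
    then show ?thesis using \<open>f' t = 0\<close> by simp
  qed
  have "\<bar>f s\<bar> \<le> real K * (s - t)\<^sup>2" if s: "s \<in> {0..T}" for s
  proof -
    have "norm (f s - f t) \<le> (real K * \<bar>s - t\<bar>) * norm (s - t)"
    proof (rule field_differentiable_bound[of "closed_segment s t"])
      fix z assume z: "z \<in> closed_segment s t"
      then have "z \<in> {0..T}" "\<bar>z - t\<bar> \<le> \<bar>s - t\<bar>"
        using s t by (auto simp: closed_segment_eq_real_ivl split: if_splits)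
      then show "norm (f' z) \<le> real K * \<bar>s - t\<bar>"
        using order_trans[OF slope[of z] mult_left_mono[of "\<bar>z - t\<bar>" "\<bar>s - t\<bar>" "real K"]] by simp
      show "(f has_real_derivative f' z) (at z within closed_segment s t)"
        using f' by (rule has_field_derivative_at_within)
    qed auto
    then show ?thesis using max(1) by (simp add: power2_eq_square mult.assoc)
  qed
  then show thesis by (rule that)
qed

text \<open>Bulinskaya's argument. If the path is quadratically small around some \<open>t\<close>, then
  on a grid of mesh \<open>T / m\<close> some value has modulus at most \<open>K * (T /
  m)\<^sup>2\<close>. Each of the \<open>m + 1\<close> grid values does this with probability
  of order \<open>1 / m\<^sup>2\<close>, so the union has probability of order \<open>1 /
  m\<close>.\<close>

lemma AE_not_quadratically_small:
  fixes Y :: "real \<Rightarrow> 'w \<Rightarrow> real"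
  assumes Y: "centered_gaussian_process M I Y C" and T: "{0..T} \<subseteq> I" "0 < T"
    and var: "\<And>t. t \<in> {0..T} \<Longrightarrow> C t t = 1"
  shows "AE \<omega> in M. \<not> (\<exists>t\<in>{0..T}. \<forall>s\<in>{0..T}. \<bar>Y s \<omega>\<bar> \<le> real K * (s - t)\<^sup>2)"
proof -
  interpret prob_space M using Y by (rule gaussian_process_prob_space)
  define g where "g n i = T * real i / real (Suc n)" for n i :: nat
  have g: "g n i \<in> {0..T}" if "i \<le> Suc n" for n i
  proof -
    have "T * real i \<le> T * real (Suc n)" using that T by (intro mult_left_mono) auto
    then show ?thesis using T by (simp add: g_def divide_le_eq)
  qed
  define \<epsilon> where "\<epsilon> n = real K * (T / real (Suc n))\<^sup>2" for n
  define A where "A n = (\<Union>i\<in>{..Suc n}. {\<omega>\<in>space M. \<bar>Y (g n i) \<omega>\<bar> \<le> \<epsilon> n})" for n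
  have ball: "{\<omega>\<in>space M. \<bar>Y (g n i) \<omega>\<bar> \<le> \<epsilon> n} \<in> sets M"
      "measure M {\<omega>\<in>space M. \<bar>Y (g n i) \<omega>\<bar> \<le> \<epsilon> n} \<le> 2 * \<epsilon> n" if "i \<le> Suc n" for n i
  proof -
    have I: "g n i \<in> I" using g[OF that] T by blast
    have [measurable]: "Y (g n i) \<in> borel_measurable M"
      by (rule gaussian_process_measurable[OF Y I])
    show "{\<omega>\<in>space M. \<bar>Y (g n i) \<omega>\<bar> \<le> \<epsilon> n} \<in> sets M" by measurable
    show "measure M {\<omega>\<in>space M. \<bar>Y (g n i) \<omega>\<bar> \<le> \<epsilon> n} \<le> 2 * \<epsilon> n"
      using gaussian_process_cov[OF Y I I] var[OF g[OF that]]
      by (intro normal_small_ball prob_space_axioms gaussian_process_normal[OF Y I])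
         (auto simp: power2_eq_square \<epsilon>_def)
  qed
  have A: "A n \<in> sets M" for n
    unfolding A_def using ball(1) by (intro sets.finite_UN) auto
  have "measure M (\<Inter>n. A n) \<le> 4 * real K * T\<^sup>2 * inverse (real (Suc n))" for n
  proof -
    have "measure M (\<Inter>n. A n) \<le> measure M (A n)"
      using A by (intro finite_measure_mono) auto
    also have "\<dots> \<le> (\<Sum>i\<in>{..Suc n}. measure M {\<omega>\<in>space M. \<bar>Y (g n i) \<omega>\<bar> \<le> \<epsilon> n})"
      unfolding A_def using ball(1) by (intro finite_measure_subadditive_finite) auto
    also have "\<dots> \<le> (\<Sum>i\<in>{..Suc n}. 2 * \<epsilon> n)"
      using ball(2) by (intro sum_mono) auto
    also have "\<dots> = 2 * \<epsilon> n * (real n + 2)"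
      by (simp add: algebra_simps)
    also have "\<dots> \<le> 2 * \<epsilon> n * (2 * real (Suc n))"
      by (intro mult_left_mono) (auto simp: \<epsilon>_def)
    also have "\<dots> = 4 * real K * T\<^sup>2 * inverse (real (Suc n))"
      unfolding \<epsilon>_def power_divide
      by (simp add: power2_eq_square divide_simps del: of_nat_Suc)
    finally show ?thesis .
  qed
  moreover have "(\<lambda>n. 4 * real K * T\<^sup>2 * inverse (real (Suc n))) \<longlonglongrightarrow> 0"
    by (intro tendsto_mult_right_zero LIMSEQ_inverse_real_of_nat)
  ultimately have "measure M (\<Inter>n. A n) \<le> 0"
    by (intro LIMSEQ_le_const) auto
  then have null: "(\<Inter>n. A n) \<in> null_sets M"
    using A by (auto intro!: null_setsI simp: emeasure_eq_measure measure_le_0_iff)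
  show ?thesis
  proof (rule AE_I'[OF null], intro subsetI INT_I)
    fix \<omega> n assume "\<omega> \<in> {\<omega>\<in>space M. \<not> \<not> (\<exists>t\<in>{0..T}. \<forall>s\<in>{0..T}. \<bar>Y s \<omega>\<bar> \<le> real K * (s - t)\<^sup>2)}"
    then obtain t where \<omega>: "\<omega> \<in> space M" and t: "t \<in> {0..T}"
      and quad: "\<And>s. s \<in> {0..T} \<Longrightarrow> \<bar>Y s \<omega>\<bar> \<le> real K * (s - t)\<^sup>2"
      by auto
    \<comment> \<open>The last grid point that is at most \<open>t\<close>.\<close>
    define i where "i = nat \<lfloor>t * real (Suc n) / T\<rfloor>"
    have nonneg: "0 \<le> t * real (Suc n) / T" using t T by simp
    then have i: "real i \<le> t * real (Suc n) / T" "t * real (Suc n) / T < real i + 1"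
      unfolding i_def by linarith+
    have "t * real (Suc n) / T \<le> real (Suc n)"
      using t T by (simp add: divide_le_eq mult.commute mult_right_mono)
    with i(1) have "i \<le> Suc n" by linarith
    have "T * real i \<le> t * real (Suc n)" "t * real (Suc n) < T * real i + T"
      using i T by (simp_all add: field_simps)
    then have "g n i \<le> t" "t \<le> (T * real i + T) / real (Suc n)"
      unfolding g_def by (simp_all add: divide_le_eq le_divide_eq del: of_nat_Suc)
    then have "\<bar>g n i - t\<bar> \<le> T / real (Suc n)"
      unfolding g_def add_divide_distrib by linarith
    then have "(g n i - t)\<^sup>2 \<le> (T / real (Suc n))\<^sup>2"
      using T by (subst abs_le_square_iff[symmetric]) simp
    then have "real K * (g n i - t)\<^sup>2 \<le> \<epsilon> n"
      unfolding \<epsilon>_def by (rule mult_left_mono) simp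
    then have "\<bar>Y (g n i) \<omega>\<bar> \<le> \<epsilon> n"
      by (rule order_trans[OF quad[OF g[OF \<open>i \<le> Suc n\<close>]]])
    then show "\<omega> \<in> A n" using \<omega> \<open>i \<le> Suc n\<close> unfolding A_def by auto
  qed
qed

text \<open>Touching zero without crossing it happens with probability zero: at the endpoints by the
  density of a single value, in the interior because contact with a maximum is quadratic. This
  links the weak inequality in the exponent of the sech process with the absence of zeros.\<close>

lemma smooth_prob_le_eq_less:
  fixes Y :: "real \<Rightarrow> 'w \<Rightarrow> real"
  assumes Y: "centered_gaussian_process M I Y C" and T: "{0..T} \<subseteq> I" "0 < T"
    and var: "\<And>t. t \<in> {0..T} \<Longrightarrow> C t t = 1"
    and smooth: "\<And>\<omega>. \<omega> \<in> space M \<Longrightarrow> C_infinity_on (\<lambda>t. Y t \<omega>) UNIV"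
  shows "measure M {\<omega>\<in>space M. \<forall>t\<in>{0..T}. Y t \<omega> \<le> 0}
    = measure M {\<omega>\<in>space M. \<forall>t\<in>{0..T}. Y t \<omega> < 0}"
proof -
  interpret prob_space M using Y by (rule gaussian_process_prob_space)
  have cont: "continuous_on {0..T} (\<lambda>t. Y t \<omega>)" if "\<omega> \<in> space M" for \<omega>
  proof -
    have "n_times_differentiable_on 0 (\<lambda>t. Y t \<omega>) UNIV"
      using smooth[OF that] unfolding C_infinity_on_def by blast
    then show ?thesis by (auto intro: continuous_on_subset)
  qed
  have nonzero: "AE \<omega> in M. Y t \<omega> \<noteq> 0" if t: "t \<in> {0..T}" for t
  proof -
    have I: "t \<in> I" using t T by blast
    have [measurable]: "Y t \<in> borel_measurable M"
      by (rule gaussian_process_measurable[OF Y I])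
    have "measure M {\<omega>\<in>space M. \<bar>Y t \<omega>\<bar> \<le> 0} \<le> 2 * 0"
      using gaussian_process_cov[OF Y I I] var[OF t]
      by (intro normal_small_ball prob_space_axioms gaussian_process_normal[OF Y I])
         (auto simp: power2_eq_square)
    then have "{\<omega>\<in>space M. Y t \<omega> = 0} \<in> null_sets M"
      by (auto intro!: null_setsI simp: emeasure_eq_measure measure_le_0_iff)
    then show ?thesis by (rule AE_I') auto
  qed
  have "AE \<omega> in M. \<forall>K. \<not> (\<exists>t\<in>{0..T}. \<forall>s\<in>{0..T}. \<bar>Y s \<omega>\<bar> \<le> real K * (s - t)\<^sup>2)"
    using AE_not_quadratically_small[OF Y T var] by (subst AE_all_countable) blast
  with nonzero[of 0] nonzero[of T]
  have "AE \<omega> in M. Y 0 \<omega> \<noteq> 0 \<and> Y T \<omega> \<noteq> 0 \<and>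
      (\<forall>K. \<not> (\<exists>t\<in>{0..T}. \<forall>s\<in>{0..T}. \<bar>Y s \<omega>\<bar> \<le> real K * (s - t)\<^sup>2))"
    using T by auto
  then have "AE \<omega> in M. (\<omega> \<in> {\<omega>\<in>space M. \<forall>t\<in>{0..T}. Y t \<omega> \<le> 0}) = (\<omega> \<in> {\<omega>\<in>space M. \<forall>t\<in>{0..T}. Y t \<omega> < 0})"
  proof (eventually_elim)
    case (elim \<omega>)
    show ?case
    proof (rule iffI)
      assume \<omega>: "\<omega> \<in> {\<omega>\<in>space M. \<forall>t\<in>{0..T}. Y t \<omega> \<le> 0}"
      have "Y t \<omega> \<noteq> 0" if t: "t \<in> {0..T}" for t
      proof
        assume 0: "Y t \<omega> = 0"
        with elim t have "0 < t" "t < T" by (auto simp: less_le)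
        then obtain K where "\<And>s. s \<in> {0..T} \<Longrightarrow> \<bar>Y s \<omega>\<bar> \<le> real K * (s - t)\<^sup>2"
          using C_infinity_touches_quadratically[OF smooth[of \<omega>] _ _ 0] \<omega> by blast
        with elim t show False by blast
      qed
      with \<omega> show "\<omega> \<in> {\<omega>\<in>space M. \<forall>t\<in>{0..T}. Y t \<omega> < 0}"
        by (auto simp: less_le)
    qed (auto intro: less_imp_le)
  qed
  then show ?thesis
    using T by (intro finite_measure_eq_AE sets_path_le[OF Y] sets_path_less[OF Y] cont) auto
qed

section \<open>Logarithmic limits and suprema\<close>

text \<open>The factor two costs at most \<open>ln 2\<close> before division by \<open>T\<close>. This
  includes \<open>q T = 0\<close>, where the convention \<open>ln 0 = 0\<close> makes both
  logarithms vanish.\<close>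

lemma ln_twice_limit:
  fixes p q :: "real \<Rightarrow> real"
  assumes lim: "((\<lambda>T. 1 / T * ln (q T)) \<longlongrightarrow> L) at_top"
    and twice: "eventually (\<lambda>T. p T = 2 * q T) at_top" and q: "\<And>T. 0 \<le> q T"
  shows "((\<lambda>T. 1 / T * ln (p T)) \<longlongrightarrow> L) at_top"
proof -
  define e where "e T = (if q T = 0 then 0 else ln 2 :: real)" for T
  have "((\<lambda>T. e T / T) \<longlongrightarrow> 0) at_top"
  proof (rule Lim_null_comparison)
    show "eventually (\<lambda>T. norm (e T / T) \<le> ln 2 / T) at_top"
      using eventually_gt_at_top[of 0] by eventually_elim (auto simp: e_def)
    show "((\<lambda>T. ln 2 / T :: real) \<longlongrightarrow> 0) at_top"
      by (intro tendsto_divide_0[OF tendsto_const] filterlim_at_top_imp_at_infinity filterlim_ident)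
  qed
  with lim have "((\<lambda>T. 1 / T * ln (q T) + e T / T) \<longlongrightarrow> L + 0) at_top"
    by (rule tendsto_add)
  moreover have "eventually (\<lambda>T. 1 / T * ln (q T) + e T / T = 1 / T * ln (p T)) at_top"
    using twice
  proof eventually_elim
    case (elim T)
    have "ln (p T) = ln (q T) + e T"
      using q[of T] unfolding elim e_def by (auto simp: ln_mult)
    then show ?case by (simp add: add_divide_distrib)
  qed
  ultimately show ?thesis
    by (simp add: tendsto_cong)
qed

lemma
  fixes f :: "real \<Rightarrow> real"
  assumes f: "continuous_on {0..T} f" and T: "0 \<le> T"
  shows SUP_path_le_iff: "(SUP t\<in>{0..T}. f t) \<le> 0 \<longleftrightarrow> (\<forall>t\<in>{0..T}. f t \<le> 0)"
    and SUP_path_less_iff: "(SUP t\<in>{0..T}. f t) < 0 \<longleftrightarrow> (\<forall>t\<in>{0..T}. f t < 0)"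
proof -
  have ne: "{0..T} \<noteq> {}" using T by simp
  obtain s where s: "s \<in> {0..T}" "\<And>t. t \<in> {0..T} \<Longrightarrow> f t \<le> f s"
    using continuous_attains_sup[OF compact_Icc ne f] by blast
  then have "(SUP t\<in>{0..T}. f t) = f s"
    by (intro cSup_eq_maximum) auto
  then show "(SUP t\<in>{0..T}. f t) \<le> 0 \<longleftrightarrow> (\<forall>t\<in>{0..T}. f t \<le> 0)"
    "(SUP t\<in>{0..T}. f t) < 0 \<longleftrightarrow> (\<forall>t\<in>{0..T}. f t < 0)"
    using s by (metis order_trans, metis le_less_trans)
qed

section \<open>The heat field along time and space\<close>

lemma heat_field_gaussian:
  fixes \<phi> :: "(real ^ 'd) \<times> real \<Rightarrow> 'w \<Rightarrow> real"
  shows "gaussian_heat_field M \<phi> \<Longrightarrow> centered_gaussian_process M (UNIV \<times> {0<..}) \<phi>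
       (\<lambda>(x, t) (y, s). heat_kernel (t + s) (x - y))"
  by (simp add: gaussian_heat_field_def)

lemma heat_field_path_continuous:
  fixes \<phi> :: "(real ^ 'd) \<times> real \<Rightarrow> 'w \<Rightarrow> real"
  assumes "gaussian_heat_field M \<phi>" "\<omega> \<in> space M"
    and "continuous_on S g" "\<And>t. t \<in> S \<Longrightarrow> snd (g t) > 0"
  shows "continuous_on S (\<lambda>t. \<phi> (g t) \<omega>)"
proof (rule continuous_on_compose2[of "UNIV \<times> {0<..}" "\<lambda>p. \<phi> p \<omega>"])
  have "n_times_differentiable_on 0 (\<lambda>p. \<phi> p \<omega>) (UNIV \<times> {0<..})"
    using assms(1,2) unfolding gaussian_heat_field_def C_infinity_on_def by blast
  then show "continuous_on (UNIV \<times> {0<..}) (\<lambda>p. \<phi> p \<omega>)" by simp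
  show "g ` S \<subseteq> UNIV \<times> {0<..}"
    by (rule image_subsetI) (simp add: mem_Times_iff assms(4))
  show "continuous_on S g" by fact
qed

text \<open>At a fixed point the variance at time \<open>exp u\<close> is \<open>(8 * pi * exp u) powr -
  p\<close>, whose inverse square root is the normalizing factor. In logarithmic time the
  process becomes stationary because \<open>exp u + exp v = 2 * exp ((u + v) / 2) * cosh ((u -
  v) / 2)\<close>.\<close>

lemma heat_field_time_gaussian:
  fixes \<phi> :: "(real ^ 'd) \<times> real \<Rightarrow> 'w \<Rightarrow> real" and x :: "real ^ 'd"
  defines "p \<equiv> real CARD('d) / 2"
  assumes phi: "gaussian_heat_field M \<phi>"
  shows "centered_gaussian_process M UNIV
    (\<lambda>u \<omega>. (8 * pi * exp u) powr (p / 2) * \<phi> (x, exp u) \<omega>)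
    (\<lambda>u v. (1 / cosh ((u - v) / 2)) powr p)"
proof (rule gaussian_process_reparam[OF heat_field_gaussian[OF phi]])
  fix u v :: real
  define m where "m = 8 * pi * exp ((u + v) / 2)"
  have m: "m > 0" by (simp add: m_def)
  have "(8 * pi * exp u) powr (p / 2) * (8 * pi * exp v) powr (p / 2) = ((8 * pi * exp u) * (8 * pi * exp v)) powr (p / 2)"
    by (rule powr_mult[symmetric]; simp)
  also have "(8 * pi * exp u) * (8 * pi * exp v) = m\<^sup>2"
    by (simp add: m_def power2_eq_square exp_add[symmetric])
  also have "m\<^sup>2 powr (p / 2) = m powr p"
    using m powr_powr[of m 2 "p / 2"] by simp
  finally have 1: "(8 * pi * exp u) powr (p / 2) * (8 * pi * exp v) powr (p / 2) = m powr p" .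
  have "exp ((u + v) / 2) * (exp ((u - v) / 2) + exp (- ((u - v) / 2))) = exp u + exp v"
    unfolding distrib_left exp_add[symmetric] by (simp add: field_simps)
  then have "4 * pi * (exp u + exp v) = m * cosh ((u - v) / 2)"
    by (simp add: m_def cosh_field_def)
  then have "heat_kernel (exp u + exp v) (x - x) = (m * cosh ((u - v) / 2)) powr - p"
    by (simp add: heat_kernel_def p_def)
  also have "\<dots> = m powr - p * cosh ((u - v) / 2) powr - p"
    using m by (simp add: powr_mult)
  finally show "(8 * pi * exp u) powr (p / 2) * (8 * pi * exp v) powr (p / 2) *
      (\<lambda>(x, t) (y, s). heat_kernel (t + s) (x - y)) (x, exp u) (x, exp v) = (1 / cosh ((u - v) / 2)) powr p"
    unfolding 1 using m by (simp add: powr_minus powr_divide field_simps)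
qed (auto intro: inj_onI)

lemma axis_eq_scaleR: "(axis i a :: real ^ 'd) = a *\<^sub>R axis i 1"
  by (simp add: vec_eq_iff axis_def)

lemma norm_axis_real: "norm (axis i a :: real ^ 'd) = \<bar>a\<bar>"
  by (subst axis_eq_scaleR) simp

text \<open>At time one the covariance is the heat kernel at time two, whose value at the origin is
  \<open>(8 * pi) powr - (1 / 2)\<close> in dimension one. By stationarity the shift
  \<open>h\<close> leaves no trace in the covariance; it moves a centred interval to
  \<open>[0, R]\<close>.\<close>

lemma heat_field_space_gaussian:
  fixes \<phi> :: "(real ^ 'd) \<times> real \<Rightarrow> 'w \<Rightarrow> real" and i :: 'd
  assumes phi: "gaussian_heat_field M \<phi>" and d: "CARD('d) = 1"
  shows "centered_gaussian_process M {0..}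
    (\<lambda>t \<omega>. (8 * pi) powr (1 / 4) * \<phi> (axis i (t - h), 1) \<omega>) (\<lambda>t s. exp (- (t - s)\<^sup>2 / 8))"
proof (rule gaussian_process_reparam[OF heat_field_gaussian[OF phi]])
  show "inj_on (\<lambda>t. (axis i (t - h) :: real ^ 'd, 1 :: real)) {0..}"
    by (auto intro!: inj_onI simp: axis_eq_axis)
  fix t s :: real
  have "norm (axis i (t - h) - axis i (s - h) :: real ^ 'd) = norm (axis i (t - s) :: real ^ 'd)"
    by (rule arg_cong[where f = norm]) (auto simp: vec_eq_iff axis_def)
  then have "(norm (axis i (t - h) - axis i (s - h) :: real ^ 'd))\<^sup>2 = (t - s)\<^sup>2"
    by (simp add: norm_axis_real)
  then have "(\<lambda>(x, t) (y, s). heat_kernel (t + s) (x - y)) (axis i (t - h) :: real ^ 'd, 1) (axis i (s - h), 1)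
      = (8 * pi) powr - (1 / 2) * exp (- (t - s)\<^sup>2 / 8)"
    using d by (simp add: heat_kernel_def)
  moreover have "(8 * pi) powr (1 / 4) * (8 * pi) powr (1 / 4) * (8 * pi) powr - (1 / 2) = 1"
    by (simp flip: powr_add)
  ultimately show "(8 * pi) powr (1 / 4) * (8 * pi) powr (1 / 4) *
      (\<lambda>(x, t) (y, s). heat_kernel (t + s) (x - y)) (axis i (t - h) :: real ^ 'd, 1) (axis i (s - h), 1)
      = exp (- (t - s)\<^sup>2 / 8)"
    by (simp only: mult.assoc[symmetric])
qed auto

theorem mainTheorem3:
  fixes M :: "'w measure" and \<phi> :: "(real ^ 'd) \<times> real \<Rightarrow> 'w \<Rightarrow> real"
    and N :: "'y measure" and Y :: "real \<Rightarrow> 'y \<Rightarrow> real" and \<alpha> b :: real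
    and L :: "'z measure" and Z :: "real \<Rightarrow> 'z \<Rightarrow> real" and b_hat :: real
  assumes phi: "gaussian_heat_field M \<phi>"
    and alpha: "\<alpha> = real CARD('d) / 2 - 1"
    and Y: "sech_process \<alpha> N Y"
    and b: "has_weak_persistence_exponent N Y b"
    and Z: "squared_exp_process L Z"
    and b_hat: "has_strict_persistence_exponent L Z b_hat"
  shows "(\<forall>x :: real ^ 'd.
           ((\<lambda>T. 1 / ln T * ln (measure M {\<omega> \<in> space M. \<forall>t\<in>{1..T}. \<phi> (x, t) \<omega> \<noteq> 0}))
              \<longlongrightarrow> - b) at_top) \<and>
         (CARD('d) = 1 \<longrightarrow>
           ((\<lambda>R. 1 / R * ln (measure M {\<omega> \<in> space M.
                     \<forall>x :: real ^ 'd. norm x \<le> R / 2 \<longrightarrow> \<phi> (x, 1) \<omega> \<noteq> 0}))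
              \<longlongrightarrow> - b_hat) at_top)"
proof (intro conjI allI impI)
  fix x :: "real ^ 'd"
  define p where "p = real CARD('d) / 2"
  define X where "X u \<omega> = (8 * pi * exp u) powr (p / 2) * \<phi> (x, exp u) \<omega>" for u \<omega>
  have X: "centered_gaussian_process M UNIV X (\<lambda>u v. (1 / cosh ((u - v) / 2)) powr p)"
    unfolding X_def[abs_def] p_def by (rule heat_field_time_gaussian[OF phi])
  have Y': "centered_gaussian_process N UNIV Y (\<lambda>u v. (1 / cosh ((u - v) / 2)) powr p)"
    using Y alpha by (simp add: sech_process_def p_def)
  have smooth: "C_infinity_on (\<lambda>t. Y t \<omega>) UNIV" if "\<omega> \<in> space N" for \<omega>
    using Y that by (simp add: sech_process_def)
  have X_cont: "continuous_on S (\<lambda>u. X u \<omega>)" if "\<omega> \<in> space M" for \<omega> S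
    unfolding X_def
    by (intro continuous_intros heat_field_path_continuous[OF phi that]) auto
  have Y_cont: "continuous_on S (\<lambda>u. Y u \<omega>)" if "\<omega> \<in> space N" for \<omega> S
  proof -
    have "n_times_differentiable_on 0 (\<lambda>t. Y t \<omega>) UNIV"
      using smooth[OF that] unfolding C_infinity_on_def by blast
    then show ?thesis by (auto intro: continuous_on_subset)
  qed
  have twice: "measure M {\<omega>\<in>space M. \<forall>u\<in>{0..U}. X u \<omega> \<noteq> 0}
      = 2 * measure N {\<omega>\<in>space N. (SUP u\<in>{0..U}. Y u \<omega>) \<le> 0}" if U: "0 < U" for U
  proof -
    have "measure M {\<omega>\<in>space M. \<forall>u\<in>{0..U}. X u \<omega> \<noteq> 0}
        = 2 * measure N {\<omega>\<in>space N. \<forall>u\<in>{0..U}. Y u \<omega> < 0}"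
      using U by (intro prob_path_nonzero_eq[OF X Y'] X_cont Y_cont) auto
    also have "measure N {\<omega>\<in>space N. \<forall>u\<in>{0..U}. Y u \<omega> < 0}
        = measure N {\<omega>\<in>space N. \<forall>u\<in>{0..U}. Y u \<omega> \<le> 0}"
      using U by (intro smooth_prob_le_eq_less[OF Y', symmetric] smooth) auto
    also have "{\<omega>\<in>space N. \<forall>u\<in>{0..U}. Y u \<omega> \<le> 0} = {\<omega>\<in>space N. (SUP u\<in>{0..U}. Y u \<omega>) \<le> 0}"
      using SUP_path_le_iff[OF Y_cont] U by (auto simp del: atLeastAtMost_iff)
    finally show ?thesis .
  qed
  have "((\<lambda>U. 1 / U * ln (measure M {\<omega>\<in>space M. \<forall>u\<in>{0..U}. X u \<omega> \<noteq> 0})) \<longlongrightarrow> - b) at_top"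
    by (rule ln_twice_limit[OF b[unfolded has_weak_persistence_exponent_def]])
       (rule eventually_mono[OF eventually_gt_at_top[of 0] twice], simp_all)
  then have "((\<lambda>T. 1 / ln T * ln (measure M {\<omega>\<in>space M. \<forall>u\<in>{0..ln T}. X u \<omega> \<noteq> 0})) \<longlongrightarrow> - b) at_top"
    using ln_at_top by (rule filterlim_compose)
  moreover have "eventually (\<lambda>T. 1 / ln T * ln (measure M {\<omega>\<in>space M. \<forall>u\<in>{0..ln T}. X u \<omega> \<noteq> 0})
      = 1 / ln T * ln (measure M {\<omega> \<in> space M. \<forall>t\<in>{1..T}. \<phi> (x, t) \<omega> \<noteq> 0})) at_top"
    using eventually_ge_at_top[of 1]
  proof eventually_elim
    case (elim T)
    have "(\<forall>t\<in>exp ` {0..ln T}. \<phi> (x, t) \<omega> \<noteq> 0) = (\<forall>u\<in>{0..ln T}. X u \<omega> \<noteq> 0)" for \<omega>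
      by (auto simp: X_def)
    moreover have "exp ` {0..ln T} = {1..T}"
    proof (intro equalityI subsetI)
      fix t assume "t \<in> {1..T}"
      then show "t \<in> exp ` {0..ln T}"
        by (intro image_eqI[of _ _ "ln t"]) auto
    qed (use elim in \<open>auto simp: ln_ge_iff\<close>)
    ultimately show ?case by simp
  qed
  ultimately show "((\<lambda>T. 1 / ln T * ln (measure M {\<omega> \<in> space M. \<forall>t\<in>{1..T}. \<phi> (x, t) \<omega> \<noteq> 0}))
              \<longlongrightarrow> - b) at_top"
    by (rule Lim_transform_eventually)
next
  assume d: "CARD('d) = 1"
  then obtain i :: 'd where i: "UNIV = {i}"
    by (auto simp: card_1_singleton_iff)
  have Z': "centered_gaussian_process L {0..} Z (\<lambda>t s. exp (- (t - s)\<^sup>2 / 8))"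
    using Z by (simp add: squared_exp_process_def)
  have Z_cont: "continuous_on {0..R} (\<lambda>t. Z t \<omega>)" if "\<omega> \<in> space L" for \<omega> R
    using Z that by (auto simp: squared_exp_process_def intro: continuous_on_subset)
  have twice: "measure M {\<omega> \<in> space M. \<forall>x :: real ^ 'd. norm x \<le> R / 2 \<longrightarrow> \<phi> (x, 1) \<omega> \<noteq> 0}
      = 2 * measure L {\<omega>\<in>space L. (SUP t\<in>{0..R}. Z t \<omega>) < 0}" if R: "0 < R" for R
  proof -
    define X where "X t \<omega> = (8 * pi) powr (1 / 4) * \<phi> (axis i (t - R / 2), 1) \<omega>" for t \<omega>
    have X: "centered_gaussian_process M {0..} X (\<lambda>t s. exp (- (t - s)\<^sup>2 / 8))"
      unfolding X_def[abs_def] by (rule heat_field_space_gaussian[OF phi d])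
    have axis: "continuous_on S (\<lambda>t. axis i (t - R / 2) :: real ^ 'd)" for S
      by (subst axis_eq_scaleR) (intro continuous_intros)
    have X_cont: "continuous_on {0..R} (\<lambda>t. X t \<omega>)" if "\<omega> \<in> space M" for \<omega>
      unfolding X_def
      by (intro continuous_intros heat_field_path_continuous[OF phi that] axis) auto
    have vec: "axis i (x $ i) = x" for x :: "real ^ 'd"
      using i by (auto simp: vec_eq_iff axis_def)
    \<comment> \<open>In dimension one the closed ball is a segment.\<close>
    have "(\<lambda>t. axis i (t - R / 2) :: real ^ 'd) ` {0..R} = {x. norm x \<le> R / 2}"
    proof (intro equalityI subsetI)
      fix x :: "real ^ 'd" assume "x \<in> {x. norm x \<le> R / 2}"
      then have "norm (axis i (x $ i) :: real ^ 'd) \<le> R / 2" by (simp add: vec)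
      then have "\<bar>x $ i\<bar> \<le> R / 2" by (simp add: norm_axis_real)
      then have "0 \<le> x $ i + R / 2" "x $ i + R / 2 \<le> R"
        unfolding abs_le_iff by linarith+
      then have "x $ i + R / 2 \<in> {0..R}" by simp
      then show "x \<in> (\<lambda>t. axis i (t - R / 2)) ` {0..R}"
        by (rule rev_image_eqI) (simp add: vec)
    next
      fix x :: "real ^ 'd" assume "x \<in> (\<lambda>t. axis i (t - R / 2)) ` {0..R}"
      then obtain t where "0 \<le> t" "t \<le> R" and x: "x = axis i (t - R / 2)" by auto
      then have "\<bar>t - R / 2\<bar> \<le> R / 2" by linarith
      then show "x \<in> {x. norm x \<le> R / 2}" unfolding x by (simp only: norm_axis_real mem_Collect_eq)
    qed
    then have "(\<forall>x :: real ^ 'd. norm x \<le> R / 2 \<longrightarrow> \<phi> (x, 1) \<omega> \<noteq> 0)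
        = (\<forall>x\<in>(\<lambda>t. axis i (t - R / 2) :: real ^ 'd) ` {0..R}. \<phi> (x, 1) \<omega> \<noteq> 0)" for \<omega>
      by simp
    also have "\<dots> \<omega> = (\<forall>t\<in>{0..R}. X t \<omega> \<noteq> 0)" for \<omega>
      by (simp add: X_def)
    finally have "measure M {\<omega> \<in> space M. \<forall>x :: real ^ 'd. norm x \<le> R / 2 \<longrightarrow> \<phi> (x, 1) \<omega> \<noteq> 0}
        = measure M {\<omega>\<in>space M. \<forall>t\<in>{0..R}. X t \<omega> \<noteq> 0}"
      by simp
    also have "\<dots> = 2 * measure L {\<omega>\<in>space L. \<forall>t\<in>{0..R}. Z t \<omega> < 0}"
      using R by (intro prob_path_nonzero_eq[OF X Z'] X_cont Z_cont) auto
    also have "{\<omega>\<in>space L. \<forall>t\<in>{0..R}. Z t \<omega> < 0} = {\<omega>\<in>space L. (SUP t\<in>{0..R}. Z t \<omega>) < 0}"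
      using SUP_path_less_iff[OF Z_cont] R by (auto simp del: atLeastAtMost_iff)
    finally show ?thesis .
  qed
  show "((\<lambda>R. 1 / R * ln (measure M {\<omega> \<in> space M.
                     \<forall>x :: real ^ 'd. norm x \<le> R / 2 \<longrightarrow> \<phi> (x, 1) \<omega> \<noteq> 0}))
              \<longlongrightarrow> - b_hat) at_top"
    by (rule ln_twice_limit[OF b_hat[unfolded has_strict_persistence_exponent_def]])
       (rule eventually_mono[OF eventually_gt_at_top[of 0] twice], simp_all)
qed

end
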